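(* The Fourier transformation $\mathcal{F}\colon f\mapsto\hat f$ is an injective linear continuous operator from $G(\mathcal{H})$ into $\mathcal{E}(\mathcal{H})$.
   Context: Notation: $n\in\mathbb{N}$ is fixed, $\|\cdot\|$ is the Euclidean norm, $\langle u,v\rangle=u_1v_1+\cdots+u_nv_n$; for multi-indices $\alpha\in\mathbb{Z}_+^n$: $|\alpha|=\alpha_1+\cdots+\alpha_n$, $\alpha!=\alpha_1!\cdots\alpha_n!$, $x^\alpha=x_1^{\alpha_1}\cdots x_n^{\alpha_n}$, $D^\alpha=\partial^{|\alpha|}/\partial x_1^{\alpha_1}\cdots\partial x_n^{\alpha_n}$. $\mathcal{H}=\{h_\nu\}_{\nu=1}^\infty$ is a fixed family of convex functions $h_\nu\colon\mathbb{R}^n\to\mathbb{R}$ such that for each $\nu\in\mathbb{N}$: 1) $h_\nu(x)=h_\nu(|x_1|,\ldots,|x_n|)$ for $x\in\mathbb{R}^n$; 2) the restriction of $h_\nu$ to $[0,\infty)^n$ is nondecreasing in each variable; 3) $\lim_{x\to\infty} h_\nu(x)/\|x\|=+\infty$; 4) for each $M>0$ there exists a constant $A_{\nu,M}>0$ such that $h_\nu(x)\le\sum_{1\le j\le n:\,x_j\ne0}x_j\ln\frac{x_j}{M}+A_{\nu,M}$ for $x\in[0,\infty)^n$; 5) there is a constant $\gamma_\nu$ with $h_\nu(x)-h_{\nu+1}(x)\ge\ln2\cdot\sum_{j=1}^n x_j-\gamma_\nu$ for $x\in[0,\infty)^n$; 6) there is a constant $l_\nu$ with $h_{\nu+1}(x+y)\le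 h_\nu(x)+h_\nu(y)+l_\nu$ for $x,y\in[0,\infty)^n$. For $\nu\in\mathbb{N}$, $m\in\mathbb{Z}_+$, let $$G_m(h_\nu)=\Big\{f\in C^m(\mathbb{R}^n):\ \|f\|_{m,h_\nu}=\sup_{x\in\mathbb{R}^n,\ \beta\in\mathbb{Z}_+^n,\ |\alpha|\le m}\frac{|x^\beta(D^\alpha f)(x)|}{\beta!\,e^{-h_\nu(\beta)}}<\infty\Big\},$$ $G(h_\nu)=\bigcap_{m\ge0}G_m(h_\nu)$ with the topology defined by the norms $\|\cdot\|_{m,h_\nu}$ ($m\in\mathbb{Z}_+$), and $G(\mathcal{H})=\bigcup_{\nu\ge1}G(h_\nu)$ with the inductive limit topology of the spaces $G(h_\nu)$. For $\nu\in\mathbb{N}$, $m\in\mathbb{Z}_+$, let $$\mathcal{E}_m(h_\nu)=\Big\{f\in C^\infty(\mathbb{R}^n):\ \rho_{m,\nu}(f)=\sup_{x\in\mathbb{R}^n,\ \alpha\in\mathbb{Z}_+^n}\frac{(1+\|x\|)^m|(D^\alpha f)(x)|}{\alpha!\,e^{-h_\nu(\alpha)}}<\infty\Big\},$$ $\mathcal{E}(h_\nu)=\bigcap_{m\ge0}\mathcal{E}_m(h_\nu)$ with the topology defined by the norms $\rho_{m,\nu}$ ($m\in\mathbb{Z}_+$), and $\mathcal{E}(\mathcal{H})=\bigcup_{\nu\ge1}\mathcal{E}(h_\nu)$ with the inductive limit topology of the spaces $\mathcal{E}(h_\nu)$. For $f\in G(\mathcal{H})$, $\hat f(x)=\frac{1}{(\sqrt{2\pi})^n}\int_{\mathbb{R}^n}f(\xi)e^{i\langle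 x,\xi\rangle}\,d\xi$, $x\in\mathbb{R}^n$. Inductive limits are taken in the locally convex sense. *)

theory Defs
  imports "HOL-Analysis.Analysis"
begin

section \<open>Multi-indices and partial derivatives\<close>

text \<open>The dimension is \<open>CARD('n)\<close>; multi-indices have type \<^typ>\<open>nat ^ 'n\<close>.\<close>

definition mi_abs :: "nat ^ 'n::finite \<Rightarrow> nat" where
  "mi_abs \<alpha> = (\<Sum>i\<in>UNIV. \<alpha> $ i)"

definition mi_fact :: "nat ^ 'n::finite \<Rightarrow> real" where
  "mi_fact \<alpha> = (\<Prod>i\<in>UNIV. fact (\<alpha> $ i))"

definition mi_vec :: "nat ^ 'n::finite \<Rightarrow> real ^ 'n" where
  "mi_vec \<alpha> = (\<chi> i. real (\<alpha> $ i))"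

definition mi_pow :: "real ^ 'n::finite \<Rightarrow> nat ^ 'n \<Rightarrow> real" where
  "mi_pow x \<alpha> = (\<Prod>i\<in>UNIV. (x $ i) ^ (\<alpha> $ i))"

definition partial :: "'n::finite \<Rightarrow> (real ^ 'n \<Rightarrow> complex) \<Rightarrow> real ^ 'n \<Rightarrow> complex" where
  "partial i f x = vector_derivative (\<lambda>t::real. f (x + t *\<^sub>R axis i 1)) (at 0)"

definition has_partial :: "'n::finite \<Rightarrow> (real ^ 'n \<Rightarrow> complex) \<Rightarrow> real ^ 'n \<Rightarrow> bool" where
  "has_partial i f x \<longleftrightarrow> (\<lambda>t::real. f (x + t *\<^sub>R axis i 1)) differentiable (at 0)"

text \<open>The index type carries no order, so the coordinates are listed in an arbitrary fixed order
  \<open>x\<^sub>1, \<dots>, x\<^sub>n\<close>. \<open>D\<close> is only used for functions in \<open>C\<^sup>m\<close> and \<open>|\<alpha>| \<le> m\<close>, where the order is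
  irrelevant.\<close>

definition coords :: "'n::finite list" where
  "coords = (SOME is. distinct is \<and> set is = UNIV)"

lemma coords: "distinct (coords :: 'n::finite list)" "set (coords :: 'n list) = UNIV"
  using someI_ex[of "\<lambda>is :: 'n list. distinct is \<and> set is = UNIV"] finite_distinct_list[of "UNIV :: 'n set"]
  unfolding coords_def by auto

definition D :: "nat ^ 'n::finite \<Rightarrow> (real ^ 'n \<Rightarrow> complex) \<Rightarrow> real ^ 'n \<Rightarrow> complex" where
  "D \<alpha> f = foldr (\<lambda>i. partial i ^^ (\<alpha> $ i)) coords f"

primrec C_k :: "nat \<Rightarrow> (real ^ 'n::finite \<Rightarrow> complex) \<Rightarrow> bool" where
  "C_k 0 f \<longleftrightarrow> continuous_on UNIV f"
| "C_k (Suc k) f \<longleftrightarrow> continuous_on UNIV f \<and> (\<forall>i. (\<forall>x. has_partial i f x) \<and> C_k k (partial i f))"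

definition C_inf :: "(real ^ 'n::finite \<Rightarrow> complex) \<Rightarrow> bool" where
  "C_inf f \<longleftrightarrow> (\<forall>k. C_k k f)"


section \<open>Weight families\<close>

definition orthant :: "(real ^ 'n::finite) set" where
  "orthant = {x. \<forall>j. 0 \<le> x $ j}"

text \<open>The family is indexed by \<open>\<nu> \<ge> 1\<close>; the value \<open>h 0\<close> is never used.\<close>

definition weight_family :: "(nat \<Rightarrow> real ^ 'n::finite \<Rightarrow> real) \<Rightarrow> bool" where
  "weight_family h \<longleftrightarrow> (\<forall>\<nu>\<ge>1.
     convex_on UNIV (h \<nu>) \<and>
     (\<forall>x. h \<nu> x = h \<nu> (\<chi> j. \<bar>x $ j\<bar>)) \<and>
     (\<forall>x\<in>orthant. \<forall>j t. x $ j \<le> t \<longrightarrow> h \<nu> x \<le> h \<nu> (\<chi> k. if k = j then t else x $ k)) \<and>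
     filterlim (\<lambda>x. h \<nu> x / norm x) at_top at_infinity \<and>
     (\<forall>M>0. \<exists>A>0. \<forall>x\<in>orthant. h \<nu> x \<le> (\<Sum>j | x $ j \<noteq> 0. x $ j * ln (x $ j / M)) + A) \<and>
     (\<exists>\<gamma>. \<forall>x\<in>orthant. h \<nu> x - h (\<nu> + 1) x \<ge> ln 2 * (\<Sum>j\<in>UNIV. x $ j) - \<gamma>) \<and>
     (\<exists>l. \<forall>x\<in>orthant. \<forall>y\<in>orthant. h (\<nu> + 1) (x + y) \<le> h \<nu> x + h \<nu> y + l))"


section \<open>Locally convex topologies on spaces of complex-valued functions\<close>

definition fun_subspace :: "('a \<Rightarrow> complex) set \<Rightarrow> bool" where
  "fun_subspace V \<longleftrightarrow> (\<lambda>x. 0) \<in> V \<and>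
     (\<forall>f\<in>V. \<forall>g\<in>V. (\<lambda>x. f x + g x) \<in> V) \<and> (\<forall>c. \<forall>f\<in>V. (\<lambda>x. c * f x) \<in> V)"

definition fun_convex :: "('a \<Rightarrow> complex) set \<Rightarrow> bool" where
  "fun_convex W \<longleftrightarrow> (\<forall>f\<in>W. \<forall>g\<in>W. \<forall>t::real. 0 \<le> t \<and> t \<le> 1 \<longrightarrow>
     (\<lambda>x. (1 - t) *\<^sub>R f x + t *\<^sub>R g x) \<in> W)"

definition lc_topology_on :: "('a \<Rightarrow> complex) set \<Rightarrow> ('a \<Rightarrow> complex) topology \<Rightarrow> bool" where
  "lc_topology_on V T \<longleftrightarrow> fun_subspace V \<and> topspace T = V \<and>
     continuous_map (prod_topology T T) T (\<lambda>(f, g). (\<lambda>x. f x + g x)) \<and>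
     continuous_map (prod_topology euclidean T) T (\<lambda>(c :: complex, f). (\<lambda>x. c * f x)) \<and>
     (\<forall>U. openin T U \<and> (\<lambda>x. 0) \<in> U \<longrightarrow>
        (\<exists>W. openin T W \<and> (\<lambda>x. 0) \<in> W \<and> W \<subseteq> U \<and> fun_convex W))"

definition norms_topology ::
  "('a \<Rightarrow> complex) set \<Rightarrow> ('i \<Rightarrow> ('a \<Rightarrow> complex) \<Rightarrow> real) \<Rightarrow> ('a \<Rightarrow> complex) topology" where
  "norms_topology V p = topology_generated_by
     {{g \<in> V. p m (\<lambda>x. g x - f x) < e} | m f e. f \<in> V \<and> e > 0}"

text \<open>The locally convex inductive limit topology is the finest locally convex topology on the
  union of the steps for which all inclusions are continuous; it is obtained as the supremum of
  all locally convex topologies with this property.\<close>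

definition lc_inductive_limit ::
  "'i set \<Rightarrow> ('i \<Rightarrow> ('a \<Rightarrow> complex) topology) \<Rightarrow> ('a \<Rightarrow> complex) topology" where
  "lc_inductive_limit I T = topology_generated_by
     {U. \<exists>\<tau>. lc_topology_on (\<Union>i\<in>I. topspace (T i)) \<tau> \<and>
             (\<forall>i\<in>I. continuous_map (T i) \<tau> (\<lambda>f. f)) \<and> openin \<tau> U}"

definition linear_operator_on ::
  "('a \<Rightarrow> complex) set \<Rightarrow> ('b \<Rightarrow> complex) set \<Rightarrow> (('a \<Rightarrow> complex) \<Rightarrow> 'b \<Rightarrow> complex) \<Rightarrow> bool" where
  "linear_operator_on V W F \<longleftrightarrow> fun_subspace V \<and> fun_subspace W \<and> (\<forall>f\<in>V. F f \<in> W) \<and>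
     (\<forall>f\<in>V. \<forall>g\<in>V. F (\<lambda>x. f x + g x) = (\<lambda>x. F f x + F g x)) \<and>
     (\<forall>c. \<forall>f\<in>V. F (\<lambda>x. c * f x) = (\<lambda>x. c * F f x))"


section \<open>The spaces \<open>G(\<H>)\<close> and \<open>\<E>(\<H>)\<close>\<close>

text \<open>Finiteness of a supremum of nonnegative reals is expressed by \<^const>\<open>bdd_above\<close>; on the
  corresponding space the real-valued supremum is then the norm.\<close>

definition G_quot :: "(real ^ 'n::finite \<Rightarrow> real) \<Rightarrow> (real ^ 'n \<Rightarrow> complex) \<Rightarrow>
    (real ^ 'n) \<times> (nat ^ 'n) \<times> (nat ^ 'n) \<Rightarrow> real" where
  "G_quot w f = (\<lambda>(x, \<beta>, \<alpha>).
     cmod (of_real (mi_pow x \<beta>) * D \<alpha> f x) / (mi_fact \<beta> * exp (- w (mi_vec \<beta>))))"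

definition G_norm :: "(real ^ 'n::finite \<Rightarrow> real) \<Rightarrow> nat \<Rightarrow> (real ^ 'n \<Rightarrow> complex) \<Rightarrow> real" where
  "G_norm w m f = Sup (G_quot w f ` {(x, \<beta>, \<alpha>). mi_abs \<alpha> \<le> m})"

definition G_m :: "(real ^ 'n::finite \<Rightarrow> real) \<Rightarrow> nat \<Rightarrow> (real ^ 'n \<Rightarrow> complex) set" where
  "G_m w m = {f. C_k m f \<and> bdd_above (G_quot w f ` {(x, \<beta>, \<alpha>). mi_abs \<alpha> \<le> m})}"

definition G_step :: "(real ^ 'n::finite \<Rightarrow> real) \<Rightarrow> (real ^ 'n \<Rightarrow> complex) set" where
  "G_step w = (\<Inter>m. G_m w m)"

definition G_space :: "(nat \<Rightarrow> real ^ 'n::finite \<Rightarrow> real) \<Rightarrow> (real ^ 'n \<Rightarrow> complex) set" where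
  "G_space h = (\<Union>\<nu>\<in>{1..}. G_step (h \<nu>))"

definition G_top :: "(nat \<Rightarrow> real ^ 'n::finite \<Rightarrow> real) \<Rightarrow> (real ^ 'n \<Rightarrow> complex) topology" where
  "G_top h = lc_inductive_limit {1..} (\<lambda>\<nu>. norms_topology (G_step (h \<nu>)) (G_norm (h \<nu>)))"

definition E_quot :: "(real ^ 'n::finite \<Rightarrow> real) \<Rightarrow> nat \<Rightarrow> (real ^ 'n \<Rightarrow> complex) \<Rightarrow>
    (real ^ 'n) \<times> (nat ^ 'n) \<Rightarrow> real" where
  "E_quot w m f = (\<lambda>(x, \<alpha>).
     (1 + norm x) ^ m * cmod (D \<alpha> f x) / (mi_fact \<alpha> * exp (- w (mi_vec \<alpha>))))"

definition E_norm :: "(real ^ 'n::finite \<Rightarrow> real) \<Rightarrow> nat \<Rightarrow> (real ^ 'n \<Rightarrow> complex) \<Rightarrow> real" where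
  "E_norm w m f = Sup (range (E_quot w m f))"

definition E_m :: "(real ^ 'n::finite \<Rightarrow> real) \<Rightarrow> nat \<Rightarrow> (real ^ 'n \<Rightarrow> complex) set" where
  "E_m w m = {f. C_inf f \<and> bdd_above (range (E_quot w m f))}"

definition E_step :: "(real ^ 'n::finite \<Rightarrow> real) \<Rightarrow> (real ^ 'n \<Rightarrow> complex) set" where
  "E_step w = (\<Inter>m. E_m w m)"

definition E_space :: "(nat \<Rightarrow> real ^ 'n::finite \<Rightarrow> real) \<Rightarrow> (real ^ 'n \<Rightarrow> complex) set" where
  "E_space h = (\<Union>\<nu>\<in>{1..}. E_step (h \<nu>))"

definition E_top :: "(nat \<Rightarrow> real ^ 'n::finite \<Rightarrow> real) \<Rightarrow> (real ^ 'n \<Rightarrow> complex) topology" where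
  "E_top h = lc_inductive_limit {1..} (\<lambda>\<nu>. norms_topology (E_step (h \<nu>)) (E_norm (h \<nu>)))"


section \<open>The Fourier transformation\<close>

definition fourier :: "(real ^ 'n::finite \<Rightarrow> complex) \<Rightarrow> real ^ 'n \<Rightarrow> complex" where
  "fourier f x = 1 / of_real (sqrt (2 * pi) ^ CARD('n)) *
     (LINT \<xi>|lborel. f \<xi> * exp (\<i> * of_real (x \<bullet> \<xi>)))"


section \<open>Carriers of the topologies\<close>

lemma topspace_norms_topology:
  fixes V :: "('a \<Rightarrow> complex) set" and p :: "'i \<Rightarrow> ('a \<Rightarrow> complex) \<Rightarrow> real"
  assumes "\<And>m. p m (\<lambda>x. 0) = 0"
  shows "topspace (norms_topology V p) = V"
proof
  show "topspace (norms_topology V p) \<subseteq> V"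
    unfolding norms_topology_def topology_generated_by_topspace by auto
  show "V \<subseteq> topspace (norms_topology V p)"
  proof
    fix f assume f: "f \<in> V"
    have "f \<in> {g \<in> V. p undefined (\<lambda>x. g x - f x) < 1}" using f assms by simp
    moreover have "{g \<in> V. p undefined (\<lambda>x. g x - f x) < 1}
        \<in> {{g \<in> V. p m (\<lambda>x. g x - f x) < e} | m f e. f \<in> V \<and> e > 0}"
      using f zero_less_one by blast
    ultimately show "f \<in> topspace (norms_topology V p)"
      unfolding norms_topology_def topology_generated_by_topspace by (rule UnionI[rotated])
  qed
qed

lemma continuous_map_indiscrete:
  assumes "f \<in> topspace S \<rightarrow> V"
  shows "continuous_map S (topology_generated_by {V}) f"
proof (rule continuous_on_generated_topo)
  have "f -` V \<inter> topspace S = topspace S" using assms by blast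
  then show "openin S (f -` U \<inter> topspace S)" if "U \<in> {V}" for U using that by simp
  show "f ` topspace S \<subseteq> \<Union> {V}" using assms by blast
qed

lemma lc_topology_on_indiscrete:
  assumes V: "fun_subspace V"
  shows "lc_topology_on V (topology_generated_by {V})"
proof -
  let ?T = "topology_generated_by {V}"
  have ts: "topspace ?T = V" by (simp add: topology_generated_by_topspace)
  have op: "U = {} \<or> U = V" if "openin ?T U" for U
  proof -
    have "generate_topology_on {V} U" using that by (simp add: openin_topology_generated_by_iff)
    then show ?thesis by (induction) auto
  qed
  have "fun_convex V" unfolding fun_convex_def
  proof (intro ballI allI impI)
    fix f g and t :: real assume "f \<in> V" "g \<in> V"
    then have "(\<lambda>x. of_real (1 - t) * f x) \<in> V" "(\<lambda>x. of_real t * g x) \<in> V"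
      using V unfolding fun_subspace_def by blast+
    then have "(\<lambda>x. of_real (1 - t) * f x + of_real t * g x) \<in> V"
      using V unfolding fun_subspace_def by fast
    then show "(\<lambda>x. (1 - t) *\<^sub>R f x + t *\<^sub>R g x) \<in> V" by (simp add: scaleR_conv_of_real)
  qed
  then have "\<exists>W. openin ?T W \<and> (\<lambda>x. 0) \<in> W \<and> W \<subseteq> U \<and> fun_convex W"
    if "openin ?T U" "(\<lambda>x. 0) \<in> U" for U
    using op[OF that(1)] that by blast
  moreover have "continuous_map (prod_topology ?T ?T) ?T (\<lambda>(f, g). (\<lambda>x. f x + g x))"
    using V by (intro continuous_map_indiscrete) (auto simp: fun_subspace_def)
  moreover have "continuous_map (prod_topology euclidean ?T) ?T (\<lambda>(c :: complex, f). (\<lambda>x. c * f x))"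
    using V by (intro continuous_map_indiscrete) (auto simp: fun_subspace_def)
  ultimately show ?thesis unfolding lc_topology_on_def using V ts by blast
qed

lemma topspace_lc_inductive_limit:
  assumes V: "fun_subspace (\<Union>i\<in>I. topspace (T i))"
  shows "topspace (lc_inductive_limit I T) = (\<Union>i\<in>I. topspace (T i))"
proof
  let ?V = "\<Union>i\<in>I. topspace (T i)"
  let ?S = "{U. \<exists>\<tau>. lc_topology_on ?V \<tau> \<and>
      (\<forall>i\<in>I. continuous_map (T i) \<tau> (\<lambda>f. f)) \<and> openin \<tau> U}"
  have ts: "topspace (lc_inductive_limit I T) = \<Union> ?S"
    unfolding lc_inductive_limit_def by (rule topology_generated_by_topspace)
  have "U \<subseteq> ?V" if "U \<in> ?S" for U
  proof -
    from that obtain \<tau> where "lc_topology_on ?V \<tau>" "openin \<tau> U" by (elim CollectE exE conjE)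
    then show ?thesis using openin_subset[of \<tau> U] by (simp add: lc_topology_on_def)
  qed
  then show "topspace (lc_inductive_limit I T) \<subseteq> ?V"
    unfolding ts by (rule Union_least)
  have "continuous_map (T i) (topology_generated_by {?V}) (\<lambda>f. f)" if "i \<in> I" for i
    using that by (intro continuous_map_indiscrete Pi_I UN_I)
  moreover have "openin (topology_generated_by {?V}) ?V"
    by (rule topology_generated_by_Basis) (rule singletonI)
  ultimately have "?V \<in> ?S"
    using lc_topology_on_indiscrete[OF V] by (intro CollectI exI conjI ballI)
  then show "?V \<subseteq> topspace (lc_inductive_limit I T)"
    unfolding ts by (rule Union_upper)
qed

end

(*
  Let f lie in G(h_nu). Its derivatives decay so fast that xi^alpha f is dominated, with explicit
  constants, by prod_i 1/(1 + xi_i^2), so D^alpha of the transform of f is, up to a unimodular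
  factor, the transform of xi^alpha f, and multiplication by x_j corresponds to differentiation in
  xi_j. Iterating the latter m times bounds |x_j|^m |D^alpha f^(x)| by (alpha + 2)! exp(-h_nu(alpha - m e_j)),
  and conditions 6) and 5) turn this into alpha! exp(-h_{nu+2}(alpha)): the transformation is bounded
  from G(h_nu) to E(h_{nu+2}). Continuity between the inductive limits follows, because a
  locally convex topology pulls back along a linear map to a locally convex topology. Injectivity is
  Fourier uniqueness, obtained by averaging against shrinking Gaussians.
*)
theory Submission
  imports Defs "HOL-Probability.Sinc_Integral" "HOL-Probability.Characteristic_Functions"
begin

section \<open>Fourier integrals of rapidly decreasing functions\<close>

text \<open>The norms of G(h_nu) control xi^beta D^alpha f for every beta but contain no integrable
  majorant, so integrability has to be bought: two extra powers in each coordinate give the factors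
  1/(1 + xi_i^2) and turn alpha! into (alpha + 2)!. The majorant is a product, so that its integral
  factors over the coordinates, and a shift of length at most 1 along an axis changes it by at most
  a factor 3, which allows differentiating translates under the integral. The quotient (alpha +
  2)!/alpha! is at most a constant times 2^|alpha|; this is the rate ln 2 of condition 5), and
  paying for it costs one index of the family. The other index pays for condition 6), which compares
  the weights at alpha - m e_j and at alpha. For (1 + ||x||)^m it is enough to treat the coordinate
  of largest modulus, so only pure derivatives of f in one direction occur.\<close>

definition decay :: "real ^ 'n::finite \<Rightarrow> real" where
  "decay x = (\<Prod>i\<in>UNIV. 1 / (1 + (x $ i)\<^sup>2))"

definition fourier_integral :: "(real ^ 'n::finite \<Rightarrow> complex) \<Rightarrow> real ^ 'n \<Rightarrow> complex" where
  "fourier_integral g x = (LINT \<xi>|lborel. g \<xi> * exp (\<i> * of_real (x \<bullet> \<xi>)))"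

text \<open>\<open>lborel\<close> is the image of the product measure over the standard basis, and
  the \<open>i\<close>-th component of a vector is its coefficient at \<open>axis i 1\<close>;
  Fubini for finite products then gives integrability and value.\<close>

lemma has_bochner_integral_lborel_prod:
  fixes \<phi> :: "'n::finite \<Rightarrow> real \<Rightarrow> 'a::{real_normed_field,banach,second_countable_topology}"
  assumes "\<And>i. integrable lborel (\<phi> i)"
  shows "has_bochner_integral lborel (\<lambda>x::real^'n. \<Prod>i\<in>UNIV. \<phi> i (x $ i))
    (\<Prod>i\<in>UNIV. LINT t|lborel. \<phi> i t)"
proof -
  interpret product_sigma_finite "\<lambda>b::real^'n. lborel :: real measure" by standard
  \<comment> \<open>The product measure is indexed by vectors, the factors by coordinates. For a
    vector that is no axis vector \<open>THE\<close> still returns some index, so every member of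
    the new family is integrable.\<close>
  define \<psi> where "\<psi> b = \<phi> (THE i. b = axis i 1)" for b :: "real^'n"
  have psi: "\<psi> (axis i 1) = \<phi> i" for i by (simp add: \<psi>_def axis_eq_axis)
  have B: "Basis = range (\<lambda>i. axis i 1 :: real^'n)" by (auto simp: Basis_vec_def)
  have inj: "inj (\<lambda>i. axis i 1 :: real^'n)" by (auto simp: inj_on_def axis_eq_axis)
  have reindex: "(\<Prod>b\<in>Basis. F b) = (\<Prod>i\<in>UNIV. F (axis i 1))" for F :: "real^'n \<Rightarrow> 'a"
    unfolding B by (simp add: prod.reindex[OF inj])
  have int: "integrable lborel (\<psi> b)" for b using assms by (simp add: \<psi>_def)
  have m[measurable]: "\<phi> i \<in> borel_measurable borel" for i
    using borel_measurable_integrable[OF assms, of i] by simp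
  let ?T = "\<lambda>f. \<Sum>b\<in>Basis. f b *\<^sub>R b :: real^'n"
  have comp: "?T f $ i = f (axis i 1)" for f i
  proof -
    have "?T f $ i = ?T f \<bullet> axis i 1" by (simp add: inner_axis)
    also have "\<dots> = f (axis i 1)" by (subst inner_sum_left_Basis) (auto simp: B)
    finally show ?thesis .
  qed
  have "has_bochner_integral (Pi\<^sub>M Basis (\<lambda>b::real^'n. lborel)) (\<lambda>f. \<Prod>b\<in>Basis. \<psi> b (f b))
      (\<Prod>b\<in>Basis. LINT t|lborel. \<psi> b t)"
    using product_integrable_prod[of Basis \<psi>] product_integral_prod[of Basis \<psi>]
    by (simp add: has_bochner_integral_iff int)
  then have "has_bochner_integral (Pi\<^sub>M Basis (\<lambda>b::real^'n. lborel)) (\<lambda>f. \<Prod>i\<in>UNIV. \<phi> i (?T f $ i))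
      (\<Prod>i\<in>UNIV. LINT t|lborel. \<phi> i t)"
    by (simp only: reindex psi comp)
  then show ?thesis
    by (subst lborel_eq) (simp add: has_bochner_integral_iff integrable_distr_eq integral_distr)
qed

lemma decay_pos: "0 < decay x"
  unfolding decay_def by (intro prod_pos) (auto intro: add_pos_nonneg)

lemma decay_le_1: "decay x \<le> 1"
  unfolding decay_def by (intro prod_le_1) (auto simp: divide_simps add_pos_nonneg)

lemma integrable_decay: "integrable lborel (decay :: real ^ 'n::finite \<Rightarrow> real)"
proof -
  have "integrable lborel (\<lambda>t::real. 1 / (1 + t\<^sup>2))"
    using integrable_inverse_1_plus_square by (simp add: set_integrable_def inverse_eq_divide)
  from has_bochner_integral_lborel_prod[OF this, where 'n='n] show ?thesis
    unfolding decay_def[abs_def] by (simp add: has_bochner_integral_iff)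
qed

lemma decay_shift:
  assumes "\<bar>s\<bar> \<le> 1"
  shows "decay (x + s *\<^sub>R axis j 1) \<le> 3 * decay x"
proof -
  have s: "s\<^sup>2 \<le> 1" using assms by (simp add: abs_square_le_1)
  \<comment> \<open>With a the j-th coordinate, 3 (1 + (a + s)^2) - (1 + a^2) = 2 (a + 3 s / 2)^2 +
    2 - 3 s^2 / 2, and the remainder is positive because s^2 is at most 1.\<close>
  have "0 \<le> (x $ j + 3 / 2 * s)\<^sup>2" by simp
  then have "1 + (x $ j)\<^sup>2 \<le> 3 * (1 + (x $ j + s)\<^sup>2)"
    using s by (simp add: power2_eq_square algebra_simps)
  then have j: "1 / (1 + (x $ j + s)\<^sup>2) \<le> 3 * (1 / (1 + (x $ j)\<^sup>2))"
    by (simp add: divide_simps add_pos_nonneg)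
  have "decay (x + s *\<^sub>R axis j 1) = 1 / (1 + (x $ j + s)\<^sup>2) * (\<Prod>i\<in>UNIV - {j}. 1 / (1 + (x $ i)\<^sup>2))"
    unfolding decay_def by (subst prod.remove[of _ j]) (auto simp: axis_def intro!: prod.cong)
  also have "\<dots> \<le> 3 * (1 / (1 + (x $ j)\<^sup>2)) * (\<Prod>i\<in>UNIV - {j}. 1 / (1 + (x $ i)\<^sup>2))"
    by (intro mult_right_mono j prod_nonneg) auto
  also have "\<dots> = 3 * decay x"
    unfolding decay_def by (subst (2) prod.remove[of _ j]) auto
  finally show ?thesis .
qed

text \<open>Dominated convergence is applied to the remainder quotients at the single point 0; the
  majorant comes from the Lipschitz bound there with integrable constant \<open>w\<close>.\<close>

lemma has_vector_derivative_integral_at_0: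
  fixes F :: "real \<Rightarrow> 'a \<Rightarrow> complex"
  assumes int: "\<And>t. integrable M (F t)" and w: "integrable M w"
    and F'[measurable]: "F' \<in> borel_measurable M"
    and der: "\<And>x. ((\<lambda>t. F t x) has_vector_derivative F' x) (at 0)"
    and bd: "\<And>t x. \<bar>t\<bar> \<le> 1 \<Longrightarrow> cmod (F t x - F 0 x) \<le> \<bar>t\<bar> * w x"
  shows "((\<lambda>t. LINT x|M. F t x) has_vector_derivative (LINT x|M. F' x)) (at 0)"
proof -
  \<comment> \<open>\<open>bd\<close> speaks only of \<open>\<bar>t\<bar> \<le> 1\<close>;
    restricting to the interval leaves the filter at 0 unchanged.\<close>
  have at: "at 0 = at (0::real) within {-1..1}" by (simp add: at_within_Icc_at)
  have lim: "((\<lambda>t. ((F t x - F 0 x) - t *\<^sub>R F' x) /\<^sub>R \<bar>t\<bar>) \<longlongrightarrow> 0) (at 0 within {-1..1})" for x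
    using der[of x] unfolding at[symmetric] has_vector_derivative_def has_derivative_at_within by simp
  \<comment> \<open>The derivative inherits the bound of the difference quotients:
    \<open>cmod (F' x) - w x\<close> is at most the norm of the remainder quotient, which tends to
    0.\<close>
  have F'w: "cmod (F' x) \<le> w x" for x
  proof -
    have "cmod (F' x) - w x \<le> cmod 0"
    proof (rule tendsto_lowerbound[OF tendsto_norm[OF lim]])
      show "\<forall>\<^sub>F t in at 0 within {-1..1}.
          cmod (F' x) - w x \<le> cmod (((F t x - F 0 x) - t *\<^sub>R F' x) /\<^sub>R \<bar>t\<bar>)"
        unfolding eventually_at_filter
      proof (intro always_eventually allI impI)
        fix t :: real assume t: "t \<noteq> 0" "t \<in> {-1..1}"
        have "cmod (t *\<^sub>R F' x) - cmod (F t x - F 0 x) \<le> cmod ((F t x - F 0 x) - t *\<^sub>R F' x)"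
          by (metis norm_minus_commute norm_triangle_ineq2)
        then have "\<bar>t\<bar> * (cmod (F' x) - w x) \<le> cmod ((F t x - F 0 x) - t *\<^sub>R F' x)"
          using bd[of t x] t by (simp add: abs_le_iff algebra_simps)
        then show "cmod (F' x) - w x \<le> cmod (((F t x - F 0 x) - t *\<^sub>R F' x) /\<^sub>R \<bar>t\<bar>)"
          using t(1) by (simp only: norm_scaleR abs_inverse abs_abs)
              (simp add: inverse_eq_divide pos_le_divide_eq mult.commute)
      qed
    qed (simp add: at[symmetric])
    then show ?thesis by simp
  qed
  have iF': "integrable M F'"
    by (rule Bochner_Integration.integrable_bound[OF w F'])
      (auto intro!: AE_I2 order.trans[OF F'w])
  have "((\<lambda>t. LINT x|M. ((F t x - F 0 x) - t *\<^sub>R F' x) /\<^sub>R \<bar>t\<bar>) \<longlongrightarrow> (LINT x|M. 0)) (at 0 within {-1..1})"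
    unfolding tendsto_at_iff_sequentially comp_def
  proof (intro allI impI)
    fix X :: "nat \<Rightarrow> real" assume X: "\<forall>i. X i \<in> {-1..1} - {0}" "X \<longlonglongrightarrow> 0"
    have Xi: "X i \<noteq> 0" "\<bar>X i\<bar> \<le> 1" for i using X(1) by (auto simp: abs_le_iff)
    show "(\<lambda>i. LINT x|M. ((F (X i) x - F 0 x) - X i *\<^sub>R F' x) /\<^sub>R \<bar>X i\<bar>) \<longlonglongrightarrow> (LINT x|M. 0)"
    \<comment> \<open>Twice \<open>w\<close>: once for the difference quotient, once for the
      derivative.\<close>
    proof (rule integral_dominated_convergence[where w="\<lambda>x. 2 * w x"])
      show "(\<lambda>x. ((F (X i) x - F 0 x) - X i *\<^sub>R F' x) /\<^sub>R \<bar>X i\<bar>) \<in> borel_measurable M" for i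
        using borel_measurable_integrable[OF int] by measurable
      show "AE x in M. (\<lambda>i. ((F (X i) x - F 0 x) - X i *\<^sub>R F' x) /\<^sub>R \<bar>X i\<bar>) \<longlonglongrightarrow> 0"
        using lim X unfolding tendsto_at_iff_sequentially comp_def by auto
      show "AE x in M. norm (((F (X i) x - F 0 x) - X i *\<^sub>R F' x) /\<^sub>R \<bar>X i\<bar>) \<le> 2 * w x" for i
      proof (rule AE_I2)
        fix x
        have "cmod ((F (X i) x - F 0 x) - X i *\<^sub>R F' x) \<le> \<bar>X i\<bar> * w x + \<bar>X i\<bar> * w x"
          by (rule order.trans[OF norm_triangle_ineq4 add_mono])
            (auto intro!: bd Xi mult_left_mono F'w)
        then show "norm (((F (X i) x - F 0 x) - X i *\<^sub>R F' x) /\<^sub>R \<bar>X i\<bar>) \<le> 2 * w x"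
          using Xi[of i] by (simp add: divide_simps mult_ac)
      qed
    qed (use w in auto)
  qed
  moreover have "(LINT x|M. ((F t x - F 0 x) - t *\<^sub>R F' x) /\<^sub>R \<bar>t\<bar>)
      = (((LINT x|M. F t x) - (LINT x|M. F 0 x)) - t *\<^sub>R (LINT x|M. F' x)) /\<^sub>R \<bar>t\<bar>" for t
    using int iF' by simp
  ultimately show ?thesis
    unfolding at has_vector_derivative_def has_derivative_at_within
    by (simp only: bounded_linear_scaleR_left integral_zero real_norm_def diff_zero simp_thms)
qed


section \<open>Fourier integrals of integrable functions\<close>

lemma cmod_character [simp]: "cmod (exp (\<i> * of_real t)) = 1"
  by (simp add: norm_exp_i_times)

lemma decay_bound_integrable:
  fixes g :: "real ^ 'n::finite \<Rightarrow> complex"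
  assumes "continuous_on UNIV g" and "\<And>\<xi>. cmod (g \<xi>) \<le> C * decay \<xi>"
  shows "integrable lborel g"
proof (rule Bochner_Integration.integrable_bound)
  show "integrable lborel (\<lambda>\<xi>::real^'n. C * decay \<xi>)" by (simp add: integrable_decay)
  show "g \<in> borel_measurable lborel" using borel_measurable_continuous_onI[OF assms(1)] by simp
  show "AE \<xi> in lborel. norm (g \<xi>) \<le> norm (C * decay \<xi>)"
    using assms(2) by (auto intro!: AE_I2 order.trans[OF _ abs_ge_self])
qed

lemma integrable_character:
  fixes g :: "real ^ 'n::finite \<Rightarrow> complex"
  assumes "integrable lborel g"
  shows "integrable lborel (\<lambda>\<xi>. g \<xi> * exp (\<i> * of_real (x \<bullet> \<xi>)))"
proof (rule Bochner_Integration.integrable_bound[OF assms])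
  have [measurable]: "g \<in> borel_measurable borel" using borel_measurable_integrable[OF assms] by simp
  show "(\<lambda>\<xi>. g \<xi> * exp (\<i> * of_real (x \<bullet> \<xi>))) \<in> borel_measurable lborel" by measurable
qed (simp add: norm_mult)

lemma cmod_fourier_integral_le:
  fixes g :: "real ^ 'n::finite \<Rightarrow> complex"
  assumes "continuous_on UNIV g" and "\<And>\<xi>. cmod (g \<xi>) \<le> C * decay \<xi>"
  shows "cmod (fourier_integral g x) \<le> C * (LINT \<xi>|lborel. decay (\<xi> :: real ^ 'n))"
proof -
  have "cmod (fourier_integral g x) \<le> (LINT \<xi>|lborel. C * decay (\<xi> :: real ^ 'n))"
    unfolding fourier_integral_def
  proof (rule order.trans[OF integral_norm_bound integral_mono])
    show "integrable lborel (\<lambda>\<xi>. cmod (g \<xi> * exp (\<i> * of_real (x \<bullet> \<xi>))))"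
      by (intro integrable_norm integrable_character decay_bound_integrable[OF assms])
  qed (use assms(2) in \<open>simp_all add: norm_mult integrable_decay\<close>)
  then show ?thesis by simp
qed

lemma continuous_on_fourier_integral:
  fixes g :: "real ^ 'n::finite \<Rightarrow> complex"
  assumes g: "integrable lborel g"
  shows "continuous_on UNIV (fourier_integral g)"
proof -
  have [measurable]: "g \<in> borel_measurable borel" using borel_measurable_integrable[OF g] by simp
  have "(\<lambda>n. fourier_integral g (X n)) \<longlonglongrightarrow> fourier_integral g x" if X: "X \<longlonglongrightarrow> x" for X x
    unfolding fourier_integral_def
  proof (rule integral_dominated_convergence[where w="\<lambda>\<xi>. cmod (g \<xi>)"])
    show "AE \<xi> in lborel. (\<lambda>n. g \<xi> * exp (\<i> * of_real (X n \<bullet> \<xi>)))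
        \<longlonglongrightarrow> g \<xi> * exp (\<i> * of_real (x \<bullet> \<xi>))"
      by (intro AE_I2 tendsto_intros X)
  qed (use g in \<open>simp_all add: norm_mult\<close>)
  then show ?thesis by (auto simp: continuous_on_sequentially comp_def)
qed

lemma cmod_exp_i_minus_1_le: "cmod (exp (\<i> * of_real t) - 1) \<le> \<bar>t\<bar>"
proof -
  have "cmod (exp (\<i> * of_real t) - (\<Sum>k\<le>0. (\<i> * of_real t) ^ k / fact k)) \<le> \<bar>t\<bar> ^ Suc 0 / fact (Suc 0)"
    using iexp_approx1[of t 0] by simp
  then show ?thesis by simp
qed

lemma has_vector_derivative_character:
  "((\<lambda>t. exp (\<i> * of_real (a + t * b))) has_vector_derivative \<i> * of_real b * exp (\<i> * of_real a)) (at 0)"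
proof -
  have "((\<lambda>z. exp (\<i> * (of_real a + z * of_real b))) has_field_derivative
      \<i> * of_real b * exp (\<i> * of_real a)) (at (of_real 0))"
    by (auto intro!: derivative_eq_intros)
  from has_vector_derivative_real_field[OF this] show ?thesis by simp
qed

lemma fourier_integral_has_partial:
  fixes g :: "real ^ 'n::finite \<Rightarrow> complex"
  assumes g: "integrable lborel g" and ig: "integrable lborel (\<lambda>\<xi>. of_real (\<xi> $ j) * g \<xi>)"
  shows "((\<lambda>t. fourier_integral g (x + t *\<^sub>R axis j 1)) has_vector_derivative
    \<i> * fourier_integral (\<lambda>\<xi>. of_real (\<xi> $ j) * g \<xi>) x) (at 0)"
proof -
  have [measurable]: "g \<in> borel_measurable borel" using borel_measurable_integrable[OF g] by simp
  have split: "(x + t *\<^sub>R axis j 1) \<bullet> \<xi> = x \<bullet> \<xi> + t * \<xi> $ j" for t and \<xi> :: "real^'n"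
    by (simp add: inner_add_left inner_axis')
  have "((\<lambda>t. LINT \<xi>|lborel. g \<xi> * exp (\<i> * of_real ((x + t *\<^sub>R axis j 1) \<bullet> \<xi>))) has_vector_derivative
      (LINT \<xi>|lborel. \<i> * (of_real (\<xi> $ j) * g \<xi> * exp (\<i> * of_real (x \<bullet> \<xi>))))) (at 0)"
  proof (rule has_vector_derivative_integral_at_0[where w="\<lambda>\<xi>. cmod (of_real (\<xi> $ j) * g \<xi>)"])
    show "((\<lambda>t. g \<xi> * exp (\<i> * of_real ((x + t *\<^sub>R axis j 1) \<bullet> \<xi>))) has_vector_derivative
      \<i> * (of_real (\<xi> $ j) * g \<xi> * exp (\<i> * of_real (x \<bullet> \<xi>)))) (at 0)" for \<xi>
      unfolding split
      using has_vector_derivative_mult_right[OF has_vector_derivative_character, of "g \<xi>" "x \<bullet> \<xi>" "\<xi> $ j"]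
      by (simp add: mult_ac)
    fix t :: real and \<xi>
    have "cmod (g \<xi> * exp (\<i> * of_real ((x + t *\<^sub>R axis j 1) \<bullet> \<xi>))
        - g \<xi> * exp (\<i> * of_real ((x + 0 *\<^sub>R axis j 1) \<bullet> \<xi>)))
      = cmod (g \<xi> * exp (\<i> * of_real (x \<bullet> \<xi>)) * (exp (\<i> * of_real (t * \<xi> $ j)) - 1))"
      unfolding split by (simp add: ring_distribs exp_add mult.assoc)
    also have "\<dots> \<le> cmod (g \<xi>) * \<bar>t * \<xi> $ j\<bar>"
      unfolding norm_mult cmod_character by (intro mult_mono cmod_exp_i_minus_1_le) auto
    finally show "cmod (g \<xi> * exp (\<i> * of_real ((x + t *\<^sub>R axis j 1) \<bullet> \<xi>))
        - g \<xi> * exp (\<i> * of_real ((x + 0 *\<^sub>R axis j 1) \<bullet> \<xi>))) \<le> \<bar>t\<bar> * cmod (of_real (\<xi> $ j) * g \<xi>)"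
      by (simp add: norm_mult abs_mult mult_ac)
  qed (use g ig in \<open>auto intro!: integrable_character integrable_norm\<close>)
  then show ?thesis unfolding fourier_integral_def by simp
qed

section \<open>Partial derivatives along lines and integration by parts\<close>

lemma has_partialD:
  assumes "has_partial j g x"
  shows "((\<lambda>t. g (x + t *\<^sub>R axis j 1)) has_vector_derivative partial j g x) (at 0)"
  using assms unfolding has_partial_def partial_def by (simp add: vector_derivative_works)

text \<open>\<open>has_partial\<close> only knows the parameter 0. Moving the base point along the
  axis gives the derivative at every parameter, as the mean value inequality requires.\<close>

lemma has_partial_line:
  assumes "has_partial j g (x + s *\<^sub>R axis j 1)"
  shows "((\<lambda>t. g (x + t *\<^sub>R axis j 1)) has_vector_derivative partial j g (x + s *\<^sub>R axis j 1)) (at s)"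
proof -
  have "((\<lambda>u. g (x + s *\<^sub>R axis j 1 + (u - s) *\<^sub>R axis j 1)) has_vector_derivative
      1 *\<^sub>R partial j g (x + s *\<^sub>R axis j 1)) (at s)"
    by (rule vector_diff_chain_at[where f="\<lambda>u. u - s" and g="\<lambda>t. g (x + s *\<^sub>R axis j 1 + t *\<^sub>R axis j 1)",
          unfolded comp_def])
      (use has_partialD[OF assms] in \<open>auto intro!: derivative_eq_intros\<close>)
  moreover have "x + s *\<^sub>R axis j 1 + (u - s) *\<^sub>R axis j 1 = x + u *\<^sub>R axis j 1" for u
    by (simp add: algebra_simps)
  ultimately show ?thesis by simp
qed

lemma partial_eqI:
  assumes "((\<lambda>t. g (x + t *\<^sub>R axis j 1)) has_vector_derivative d) (at 0)"
  shows "partial j g x = d" "has_partial j g x"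
  using assms unfolding partial_def has_partial_def
  by (auto intro: vector_derivative_at differentiableI_vector)

lemma integral_lborel_translate:
  fixes f :: "'a::euclidean_space \<Rightarrow> complex"
  assumes [measurable]: "f \<in> borel_measurable borel"
  shows "(LINT \<xi>|lborel. f (c + \<xi>)) = (LINT \<xi>|lborel. f \<xi>)"
  by (subst (2) lborel_distr_plus[symmetric, of c]) (simp add: integral_distr)

text \<open>Translating the integrand by \<open>t\<close> multiplies the transform by \<open>exp (- \<i> t x\<^sub>j)\<close>; comparing the
  derivatives at \<open>t = 0\<close> gives integration by parts without iterated integrals.\<close>

lemma fourier_integral_partial:
  fixes g :: "real ^ 'n::finite \<Rightarrow> complex"
  assumes cg: "continuous_on UNIV g" and cp: "continuous_on UNIV (partial j g)"
    and hp: "\<And>\<xi>. has_partial j g \<xi>"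
    and bg: "\<And>\<xi>. cmod (g \<xi>) \<le> C * decay \<xi>" and bp: "\<And>\<xi>. cmod (partial j g \<xi>) \<le> C * decay \<xi>"
  shows "fourier_integral (partial j g) x = - \<i> * of_real (x $ j) * fourier_integral g x"
proof -
  have C: "0 \<le> C"
    using order.trans[OF norm_ge_zero bg[of 0]] decay_pos[of "0::real^'n"] by (simp add: zero_le_mult_iff)
  have [measurable]: "g \<in> borel_measurable borel" "partial j g \<in> borel_measurable borel"
    using cg cp by (auto intro: borel_measurable_continuous_onI)
  let ?F = "\<lambda>t \<xi>. g (\<xi> + t *\<^sub>R axis j 1) * exp (\<i> * of_real (x \<bullet> \<xi>))"
  have A: "((\<lambda>t. LINT \<xi>|lborel. ?F t \<xi>) has_vector_derivative
      (LINT \<xi>|lborel. partial j g \<xi> * exp (\<i> * of_real (x \<bullet> \<xi>)))) (at 0)"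
  proof (rule has_vector_derivative_integral_at_0[where w="\<lambda>\<xi>. 3 * C * decay \<xi>"])
    show "integrable lborel (?F t)" for t
    proof -
      have "integrable lborel (\<lambda>\<xi>. g (t *\<^sub>R axis j 1 + \<xi>))"
        using decay_bound_integrable[OF cg bg]
        by (subst (asm) lborel_distr_plus[symmetric, of "t *\<^sub>R axis j 1"]) (simp add: integrable_distr_eq)
      then show ?thesis by (intro integrable_character) (simp add: add.commute)
    qed
    show "((\<lambda>t. ?F t \<xi>) has_vector_derivative partial j g \<xi> * exp (\<i> * of_real (x \<bullet> \<xi>))) (at 0)" for \<xi>
      by (rule has_vector_derivative_mult_left has_partialD hp)+
    fix t :: real and \<xi> :: "real^'n" assume t: "\<bar>t\<bar> \<le> 1"
    \<comment> \<open>Mean value inequality on \<open>[-1, 1]\<close>; the factor 3 is the loss in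
      \<open>decay_shift\<close> when the bound at the shifted point is brought back to
      \<open>\<xi>\<close>.\<close>
    have "cmod (g (\<xi> + t *\<^sub>R axis j 1) - g (\<xi> + 0 *\<^sub>R axis j 1)) \<le> (3 * C * decay \<xi>) * norm (t - 0)"
    proof (rule differentiable_bound[where S="{-1..1}" and f'="\<lambda>s h. h *\<^sub>R partial j g (\<xi> + s *\<^sub>R axis j 1)"])
      show "((\<lambda>s. g (\<xi> + s *\<^sub>R axis j 1)) has_derivative (\<lambda>h. h *\<^sub>R partial j g (\<xi> + s *\<^sub>R axis j 1)))
          (at s within {-1..1})" for s
        using has_partial_line[OF hp] unfolding has_vector_derivative_def
        by (rule has_derivative_at_withinI)
      fix s :: real assume "s \<in> {-1..1}"
      then have "C * decay (\<xi> + s *\<^sub>R axis j 1) \<le> C * (3 * decay \<xi>)"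
        by (intro mult_left_mono decay_shift C) (auto simp: abs_le_iff)
      then have "cmod (partial j g (\<xi> + s *\<^sub>R axis j 1)) \<le> 3 * C * decay \<xi>"
        using bp[of "\<xi> + s *\<^sub>R axis j 1"] by simp
      then show "onorm (\<lambda>h. h *\<^sub>R partial j g (\<xi> + s *\<^sub>R axis j 1)) \<le> 3 * C * decay \<xi>"
        by (intro onorm_le) (simp add: mult.commute mult_left_mono)
    qed (use t in \<open>auto simp: abs_le_iff\<close>)
    then show "cmod (?F t \<xi> - ?F 0 \<xi>) \<le> \<bar>t\<bar> * (3 * C * decay \<xi>)"
      by (simp only: left_diff_distrib[symmetric] norm_mult cmod_character) (simp add: mult_ac)
  qed (auto simp: integrable_decay)
  \<comment> \<open>Translation moves the shift from \<open>g\<close> to the character, where the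
    dependence on \<open>t\<close> becomes an explicit factor.\<close>
  have "(LINT \<xi>|lborel. ?F t \<xi>) = exp (\<i> * of_real (- t * x $ j)) * fourier_integral g x" for t
  proof -
    have "(LINT \<xi>|lborel. ?F t \<xi>)
        = (LINT \<xi>|lborel. g \<xi> * exp (\<i> * of_real (x \<bullet> (\<xi> - t *\<^sub>R axis j 1))))"
      by (subst integral_lborel_translate[symmetric, where c="t *\<^sub>R axis j 1"]) (simp_all add: add.commute)
    also have "\<dots> = (LINT \<xi>|lborel. exp (\<i> * of_real (- t * x $ j)) * (g \<xi> * exp (\<i> * of_real (x \<bullet> \<xi>))))"
      by (simp add: inner_diff_right inner_axis ring_distribs exp_diff exp_minus field_simps)
    finally show ?thesis by (simp add: fourier_integral_def)
  qed
  then have "((\<lambda>t. LINT \<xi>|lborel. ?F t \<xi>) has_vector_derivative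
      - \<i> * of_real (x $ j) * fourier_integral g x) (at 0)"
    using has_vector_derivative_mult_left[OF has_vector_derivative_character[of 0 "- x $ j"],
        of "fourier_integral g x"] by simp
  then show ?thesis
    unfolding fourier_integral_def[of "partial j g"] by (rule vector_derivative_unique_at[OF A])
qed

section \<open>Fourier uniqueness\<close>

definition gauss :: "real ^ 'n::finite \<Rightarrow> real" where
  "gauss x = (\<Prod>i\<in>UNIV. exp (- (x $ i)\<^sup>2 / 2))"

text \<open>This is the characteristic function of the standard normal distribution, multiplied by
  \<open>sqrt (2 * pi)\<close> to undo the normalisation of the density.\<close>

lemma has_bochner_integral_gauss_character_real:
  "has_bochner_integral lborel (\<lambda>t::real. of_real (exp (- t\<^sup>2 / 2)) * exp (\<i> * of_real (a * t)))
    (of_real (sqrt (2 * pi) * exp (- a\<^sup>2 / 2)) :: complex)"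
proof -
  have std: "integrable lborel std_normal_density" by (rule integrable_normal_density) simp
  have int: "integrable lborel (\<lambda>t. std_normal_density t *\<^sub>R exp (\<i> * of_real (a * t)))"
    by (rule Bochner_Integration.integrable_bound[OF std]) auto
  have "of_real (exp (- a\<^sup>2 / 2)) = char std_normal_distribution a"
    by (simp add: char_std_normal_distribution)
  also have "\<dots> = (LINT t|lborel. std_normal_density t *\<^sub>R exp (\<i> * of_real (a * t)))"
    unfolding char_def by (subst integral_density) auto
  finally have "has_bochner_integral lborel (\<lambda>t. std_normal_density t *\<^sub>R exp (\<i> * of_real (a * t)))
      (of_real (exp (- a\<^sup>2 / 2)))"
    using int by (simp add: has_bochner_integral_iff)
  from has_bochner_integral_mult_right[OF this, of "of_real (sqrt (2 * pi))"] show ?thesis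
    by (simp add: std_normal_density_def scaleR_conv_of_real field_simps)
qed

lemma integrable_gauss: "integrable lborel (gauss :: real ^ 'n::finite \<Rightarrow> real)"
proof -
  have "integrable lborel (\<lambda>t::real. complex_of_real (exp (- t\<^sup>2 / 2)))"
    using has_bochner_integral_gauss_character_real[of 0] by (simp add: has_bochner_integral_iff)
  then have "integrable lborel (\<lambda>t::real. exp (- t\<^sup>2 / 2))" by (simp only: complex_of_real_integrable_eq)
  from has_bochner_integral_lborel_prod[OF this, where 'n='n] show ?thesis
    unfolding gauss_def[abs_def] by (simp add: has_bochner_integral_iff)
qed

lemma fourier_integral_gauss:
  fixes x :: "real ^ 'n::finite"
  shows "fourier_integral (\<lambda>\<xi>. of_real (gauss \<xi>)) x = of_real (sqrt (2 * pi) ^ CARD('n) * gauss x)"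
proof -
  have *: "has_bochner_integral lborel (\<lambda>\<xi>::real^'n. \<Prod>i\<in>UNIV. complex_of_real (exp (- (\<xi> $ i)\<^sup>2 / 2)) *
      exp (\<i> * of_real (x $ i * \<xi> $ i)))
      (\<Prod>i\<in>UNIV. of_real (sqrt (2 * pi) * exp (- (x $ i)\<^sup>2 / 2)))"
    using has_bochner_integral_lborel_prod[of "\<lambda>i t. complex_of_real (exp (- t\<^sup>2 / 2)) *
        exp (\<i> * of_real (x $ i * t))"]
      has_bochner_integral_gauss_character_real[of "x $ i" for i]
    by (simp only: has_bochner_integral_iff)
  have "(\<Prod>i\<in>UNIV. complex_of_real (exp (- (\<xi> $ i)\<^sup>2 / 2)) * exp (\<i> * of_real (x $ i * \<xi> $ i)))
      = of_real (gauss \<xi>) * exp (\<i> * of_real (x \<bullet> \<xi>))" for \<xi> :: "real^'n"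
    by (simp add: gauss_def prod.distrib inner_vec_def exp_sum sum_distrib_left)
  with * have "fourier_integral (\<lambda>\<xi>. of_real (gauss \<xi>)) x
      = (\<Prod>i\<in>UNIV. of_real (sqrt (2 * pi) * exp (- (x $ i)\<^sup>2 / 2)))"
    unfolding fourier_integral_def by (simp add: has_bochner_integral_iff)
  then show ?thesis by (simp add: gauss_def prod.distrib)
qed

lemma integral_lborel_affine:
  fixes f :: "'a::euclidean_space \<Rightarrow> complex"
  assumes [measurable]: "f \<in> borel_measurable borel" and "c > 0"
  shows "(LINT \<xi>|lborel. f \<xi>) = of_real (c ^ DIM('a)) * (LINT z|lborel. f (a + c *\<^sub>R z))"
proof -
  have "(LINT \<xi>|lborel. f \<xi>) = (LINT \<xi>|distr lborel borel (\<lambda>z. a + c *\<^sub>R z). c ^ DIM('a) *\<^sub>R f \<xi>)"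
    using assms(2) by (subst lborel_affine[of c a]) (simp_all add: integral_density)
  also have "\<dots> = (LINT z|lborel. c ^ DIM('a) *\<^sub>R f (a + c *\<^sub>R z))"
    by (rule integral_distr) measurable
  finally show ?thesis by (simp add: scaleR_conv_of_real)
qed

text \<open>Integrating the vanishing transform against a modulated Gaussian shows, by Fubini, that every
  Gaussian average of \<open>u\<close> around \<open>y\<close> vanishes.\<close>

lemma gauss_average_eq_0:
  fixes u :: "real ^ 'n::finite \<Rightarrow> complex"
  assumes u: "integrable lborel u" and zero: "\<And>x. fourier_integral u x = 0" and c: "c > 0"
  shows "(LINT z|lborel. u (y + c *\<^sub>R z) * of_real (gauss z)) = 0"
proof -
  have [measurable]: "u \<in> borel_measurable borel" using borel_measurable_integrable[OF u] by simp
  have [measurable]: "gauss \<in> borel_measurable (borel :: (real^'n) measure)"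
    using borel_measurable_integrable[OF integrable_gauss] by simp
  \<comment> \<open>The double integrand. For fixed \<open>x\<close> it is a multiple of the
    integrand of the transform of \<open>u\<close> at \<open>x / c\<close> (\<open>F1\<close>), for
    fixed \<open>\<xi>\<close> a multiple of the integrand of the transform of \<open>gauss\<close>
    at \<open>(\<xi> - y) / c\<close> (\<open>F2\<close>).\<close>
  define F where "F x \<xi>
      = u \<xi> * of_real (gauss x) * exp (\<i> * of_real (x \<bullet> ((\<xi> - y) /\<^sub>R c)))" for x \<xi> :: "real^'n"
  have F1: "F x \<xi> = of_real (gauss x) * exp (- \<i> * of_real (x \<bullet> (y /\<^sub>R c)))
      * (u \<xi> * exp (\<i> * of_real ((x /\<^sub>R c) \<bullet> \<xi>)))" for x \<xi>
    unfolding F_def by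
        (simp add: inner_diff_right scaleR_diff_right ring_distribs exp_diff exp_minus divide_inverse)
  have F2: "F x \<xi> = u \<xi> * (of_real (gauss x) * exp (\<i> * of_real (((\<xi> - y) /\<^sub>R c) \<bullet> x)))" for x \<xi>
    unfolding F_def by (simp add: inner_commute)
  have "integrable (lborel \<Otimes>\<^sub>M lborel) (\<lambda>(x, \<xi>). F x \<xi>)"
  proof (rule lborel_pair.Fubini_integrable)
    show "(\<lambda>(x, \<xi>). F x \<xi>) \<in> borel_measurable (lborel \<Otimes>\<^sub>M lborel)" unfolding F_def by measurable
    have n: "cmod (F x \<xi>) = cmod (u \<xi>) * \<bar>gauss x\<bar>" for x \<xi>
      unfolding F_def norm_mult by simp
    show "integrable lborel (\<lambda>x. LINT \<xi>|lborel. norm (case (x, \<xi>) of (x, \<xi>) \<Rightarrow> F x \<xi>))"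
      by (simp add: n integrable_gauss integrable_abs)
    show "AE x in lborel. integrable lborel (\<lambda>\<xi>. case (x, \<xi>) of (x, \<xi>) \<Rightarrow> F x \<xi>)"
      unfolding F1 prod.case by (intro AE_I2 integrable_mult_right integrable_character u)
  qed
  from lborel_pair.Fubini_integral[OF this]
  have "(LINT \<xi>|lborel. LINT x|lborel. F x \<xi>) = (LINT x|lborel. LINT \<xi>|lborel. F x \<xi>)" .
  also have "\<dots> = 0"
    by (simp only: F1 integral_mult_right_zero zero[unfolded fourier_integral_def]) simp
  finally have "(LINT \<xi>|lborel. LINT x|lborel. F x \<xi>) = 0" .
  moreover have "(LINT x|lborel. F x \<xi>) = of_real (sqrt (2 * pi) ^ CARD('n))
      * (u \<xi> * of_real (gauss ((\<xi> - y) /\<^sub>R c)))" for \<xi>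
    using fourier_integral_gauss[of "(\<xi> - y) /\<^sub>R c"] unfolding F2 by (simp add: fourier_integral_def)
  ultimately have "(LINT \<xi>|lborel. u \<xi> * of_real (gauss ((\<xi> - y) /\<^sub>R c))) = 0"
    by simp
  \<comment> \<open>The substitution \<xi> = y + c z turns the scaled Gaussian around
    \<open>y\<close> into the fixed one.\<close>
  then have "of_real (c ^ CARD('n)) * (LINT z|lborel. u (y + c *\<^sub>R z) * of_real (gauss ((y + c *\<^sub>R z - y) /\<^sub>R c)))
      = 0"
    using c by (subst (asm) integral_lborel_affine[where c=c and a=y]) simp_all
  then show ?thesis using c by simp
qed

text \<open>With \<open>c = 1 / (n + 1)\<close> the vanishing Gaussian averages converge to
  \<open>u y\<close> times the integral of \<open>gauss\<close>: \<open>u\<close> is continuous at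
  \<open>y\<close>, and being bounded by \<open>C\<close> it admits the majorant
  \<open>C * gauss\<close>.\<close>

theorem fourier_integral_eq_0_imp:
  fixes u :: "real ^ 'n::finite \<Rightarrow> complex"
  assumes cu: "continuous_on UNIV u" and bd: "\<And>\<xi>. cmod (u \<xi>) \<le> C * decay \<xi>"
    and zero: "\<And>x. fourier_integral u x = 0"
  shows "u y = 0"
proof -
  have [measurable]: "u \<in> borel_measurable borel" using cu by (rule borel_measurable_continuous_onI)
  have [measurable]: "gauss \<in> borel_measurable (borel :: (real^'n) measure)"
    using borel_measurable_integrable[OF integrable_gauss] by simp
  have g0: "0 \<le> gauss z" for z :: "real^'n" unfolding gauss_def by (intro prod_nonneg) auto
  have C: "0 \<le> C"
    using order.trans[OF norm_ge_zero bd[of 0]] decay_pos[of "0::real^'n"] by (simp add: zero_le_mult_iff)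
  have uC: "cmod (u \<xi>) \<le> C" for \<xi>
    using order.trans[OF bd mult_left_mono[OF decay_le_1 C]] by simp
  have "(\<lambda>n. LINT z|lborel. u (y + (1 / real (Suc n)) *\<^sub>R z) * of_real (gauss z))
      \<longlonglongrightarrow> (LINT z|lborel. u y * of_real (gauss (z :: real ^ 'n)))"
  proof (rule integral_dominated_convergence[where w="\<lambda>z :: real ^ 'n. C * gauss z"])
    show "AE z in lborel. (\<lambda>n. u (y + (1 / real (Suc n)) *\<^sub>R z) * of_real (gauss z))
        \<longlonglongrightarrow> u y * of_real (gauss z)"
    proof (intro AE_I2 tendsto_mult tendsto_const)
      fix z
      have "(\<lambda>n. y + (1 / real (Suc n)) *\<^sub>R z) \<longlonglongrightarrow> y + 0 *\<^sub>R z"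
        by (intro tendsto_intros LIMSEQ_Suc lim_1_over_n)
      then have "(\<lambda>n. y + (1 / real (Suc n)) *\<^sub>R z) \<longlonglongrightarrow> y" by simp
      then show "(\<lambda>n. u (y + (1 / real (Suc n)) *\<^sub>R z)) \<longlonglongrightarrow> u y"
        using cu unfolding continuous_on_sequentially comp_def by blast
    qed
    show "AE z in lborel. norm (u (y + (1 / real (Suc n)) *\<^sub>R z) * of_real (gauss z)) \<le> C * gauss z" for n
      by (intro AE_I2) (simp add: norm_mult mult_right_mono uC g0)
  qed (simp_all add: integrable_gauss)
  moreover have "(LINT z|lborel. u (y + (1 / real (Suc n)) *\<^sub>R z) * of_real (gauss z)) = 0" for n
    by (intro gauss_average_eq_0 decay_bound_integrable[OF cu bd] zero) simp
  \<comment> \<open>The integral of \<open>gauss\<close> is read as its transform at 0, a power of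
    \<open>sqrt (2 * pi)\<close> and hence not 0.\<close>
  ultimately have "u y * fourier_integral (\<lambda>z. of_real (gauss z)) (0 :: real ^ 'n) = 0"
    by (simp add: LIMSEQ_const_iff fourier_integral_def)
  moreover have "gauss (0 :: real^'n) = 1" by (simp add: gauss_def)
  ultimately show ?thesis by (simp add: fourier_integral_gauss)
qed

section \<open>The steps of the inductive limits\<close>

lemma C_inf_continuous: "C_inf f \<Longrightarrow> continuous_on UNIV f"
  unfolding C_inf_def by (metis C_k.simps(1))

lemma C_inf_has_partial: "C_inf f \<Longrightarrow> has_partial i f x"
  unfolding C_inf_def by (metis C_k.simps(2))

lemma C_inf_partial: "C_inf f \<Longrightarrow> C_inf (partial i f)"
  unfolding C_inf_def by (metis C_k.simps(2))

lemma C_inf_funpow: "C_inf f \<Longrightarrow> C_inf ((partial i ^^ k) f)"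
  by (induction k) (auto intro: C_inf_partial)

text \<open>Two coefficients at once, so that sums, scalar multiples and differences all become
  instances. Differentiability is carried along because linearity of \<open>partial\<close> rests on
  it at the next order.\<close>

lemma partial_lincomb:
  assumes "has_partial i f x" "has_partial i g x"
  shows "partial i (\<lambda>x. a * f x + b * g x) x = a * partial i f x + b * partial i g x"
    and "has_partial i (\<lambda>x. a * f x + b * g x) x"
proof -
  have "((\<lambda>t. a * f (x + t *\<^sub>R axis i 1) + b * g (x + t *\<^sub>R axis i 1)) has_vector_derivative
      a * partial i f x + b * partial i g x) (at 0)"
    by (intro has_vector_derivative_add has_vector_derivative_mult_right has_partialD assms)
  from partial_eqI[of "\<lambda>x. a * f x + b * g x", OF this]
  show "partial i (\<lambda>x. a * f x + b * g x) x = a * partial i f x + b * partial i g x"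
    and "has_partial i (\<lambda>x. a * f x + b * g x) x" .
qed

lemma C_k_lincomb: "C_k k f \<Longrightarrow> C_k k g \<Longrightarrow> C_k k (\<lambda>x. a * f x + b * g x)"
proof (induction k arbitrary: f g)
  case 0
  then show ?case by (auto intro!: continuous_intros)
next
  case (Suc k)
  then have "partial i (\<lambda>x. a * f x + b * g x) = (\<lambda>x. a * partial i f x + b * partial i g x)" for i
    by (intro ext partial_lincomb) auto
  with Suc show ?case by (auto intro!: continuous_intros partial_lincomb)
qed

lemma C_inf_lincomb: "C_inf f \<Longrightarrow> C_inf g \<Longrightarrow> C_inf (\<lambda>x. a * f x + b * g x)"
  unfolding C_inf_def by (simp add: C_k_lincomb)

lemma funpow_partial_lincomb:
  assumes "C_inf f" "C_inf g"
  shows "(partial i ^^ k) (\<lambda>x. a * f x + b * g x) = (\<lambda>x. a * (partial i ^^ k) f x + b * (partial i ^^ k) g x)"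
proof (induction k)
  case (Suc k)
  then show ?case
    using assms by (auto intro!: partial_lincomb C_inf_has_partial C_inf_funpow)
qed simp

lemma D_lincomb:
  assumes "C_inf f" "C_inf g"
  shows "D \<alpha> (\<lambda>x. a * f x + b * g x) = (\<lambda>x. a * D \<alpha> f x + b * D \<alpha> g x)"
proof -
  \<comment> \<open>\<open>D\<close> folds over the fixed list \<open>coords\<close>; the induction
    needs arbitrary lists and the smoothness of each partial fold.\<close>
  define E where "E xs f = foldr (\<lambda>i. partial i ^^ (\<alpha> $ i)) xs f" for xs f
  have "C_inf (E xs f)" if "C_inf f" for xs f
    using that unfolding E_def by (induction xs) (auto intro: C_inf_funpow)
  then have "E xs (\<lambda>x. a * f x + b * g x) = (\<lambda>x. a * E xs f x + b * E xs g x)" for xs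
    using assms by (induction xs) (auto simp: E_def funpow_partial_lincomb)
  then show ?thesis by (simp add: D_def E_def)
qed

text \<open>Connects the pure derivatives produced by integration by parts with the multi-index
  derivatives in \<open>G_quot\<close>; since \<open>coords\<close> is distinct, \<open>j\<close>
  contributes exactly once.\<close>

lemma D_axis: "D (\<chi> i. if i = j then k else 0) f = (partial j ^^ k) f"
proof -
  have "foldr (\<lambda>i. partial i ^^ ((\<chi> i. if i = j then k else 0) $ i)) xs f
      = (if j \<in> set xs then (partial j ^^ k) f else f)" if "distinct xs" for xs
    using that by (induction xs) auto
  from this[OF coords(1)] show ?thesis by (simp add: D_def coords(2))
qed

text \<open>A real \<open>Sup\<close> acts as a norm only on bounded sets, so both facts are derived
  together: boundedness gives membership in a step, the estimate gives the triangle
  inequality.\<close>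

lemma Sup_lincomb_le:
  fixes q q1 q2 :: "'p \<Rightarrow> real"
  assumes "A \<noteq> {}" "0 \<le> a" "0 \<le> b" "bdd_above (q1 ` A)" "bdd_above (q2 ` A)"
    and q: "\<And>p. p \<in> A \<Longrightarrow> q p \<le> a * q1 p + b * q2 p"
  shows "bdd_above (q ` A)" "Sup (q ` A) \<le> a * Sup (q1 ` A) + b * Sup (q2 ` A)"
proof -
  have le: "q p \<le> a * Sup (q1 ` A) + b * Sup (q2 ` A)" if "p \<in> A" for p
    using assms that
    by (intro order.trans[OF q[OF that] add_mono] mult_left_mono cSup_upper) auto
  then show "bdd_above (q ` A)" "Sup (q ` A) \<le> a * Sup (q1 ` A) + b * Sup (q2 ` A)"
    using assms(1) by (auto intro!: bdd_aboveI2 cSUP_least)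
qed

lemma mi_fact_pos: "0 < mi_fact \<alpha>"
  unfolding mi_fact_def by (simp add: prod_pos)

lemma mi_quot_nonneg: "0 \<le> t \<Longrightarrow> 0 \<le> t / (mi_fact \<beta> * exp r)"
  using mi_fact_pos[of \<beta>] by simp

lemma mem_G_step:
  "f \<in> G_step w \<longleftrightarrow> C_inf f \<and> (\<forall>m. bdd_above (G_quot w f ` {(x, \<beta>, \<alpha>). mi_abs \<alpha> \<le> m}))"
  unfolding G_step_def G_m_def C_inf_def by auto

lemma mem_E_step: "f \<in> E_step w \<longleftrightarrow> C_inf f \<and> (\<forall>m. bdd_above (range (E_quot w m f)))"
  unfolding E_step_def E_m_def by auto

lemma G_index_nonempty: "{(x :: real ^ 'n::finite, \<beta> :: nat ^ 'n, \<alpha> :: nat ^ 'n). mi_abs \<alpha> \<le> m} \<noteq> {}"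
proof -
  have "(0, 0, 0) \<in> {(x :: real ^ 'n, \<beta> :: nat ^ 'n, \<alpha> :: nat ^ 'n). mi_abs \<alpha> \<le> m}"
    by (simp add: mi_abs_def)
  then show ?thesis by blast
qed

lemma G_quot_lincomb:
  assumes "C_inf f" "C_inf g"
  shows "G_quot w (\<lambda>x. a * f x + b * g x) p \<le> cmod a * G_quot w f p + cmod b * G_quot w g p"
proof (cases p)
  case (fields x \<beta> \<alpha>)
  let ?c = "mi_fact \<beta> * exp (- w (mi_vec \<beta>))"
  have "cmod (of_real (mi_pow x \<beta>) * D \<alpha> (\<lambda>x. a * f x + b * g x) x)
      \<le> cmod (a * (of_real (mi_pow x \<beta>) * D \<alpha> f x)) + cmod (b * (of_real (mi_pow x \<beta>) * D \<alpha> g x))"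
    unfolding D_lincomb[OF assms] by (rule order.trans[OF _ norm_triangle_ineq])
        (simp add: ring_distribs mult_ac)
  from divide_right_mono[OF this, of ?c] show ?thesis
    using mi_fact_pos[of \<beta>] by (simp add: fields G_quot_def norm_mult add_divide_distrib)
qed

lemma E_quot_lincomb:
  assumes "C_inf f" "C_inf g"
  shows "E_quot w m (\<lambda>x. a * f x + b * g x) p \<le> cmod a * E_quot w m f p + cmod b * E_quot w m g p"
proof (cases p)
  case (Pair x \<alpha>)
  let ?c = "mi_fact \<alpha> * exp (- w (mi_vec \<alpha>))"
  have "cmod (D \<alpha> (\<lambda>x. a * f x + b * g x) x) \<le> cmod a * cmod (D \<alpha> f x) + cmod b * cmod (D \<alpha> g x)"
    unfolding D_lincomb[OF assms] by (rule order.trans[OF norm_triangle_ineq]) (simp add: norm_mult)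
  then have "(1 + norm x) ^ m * cmod (D \<alpha> (\<lambda>x. a * f x + b * g x) x)
      \<le> (1 + norm x) ^ m * (cmod a * cmod (D \<alpha> f x) + cmod b * cmod (D \<alpha> g x))"
    by (intro mult_left_mono) auto
  from divide_right_mono[OF this, of ?c] show ?thesis
    using mi_fact_pos[of \<alpha>] by (simp add: Pair E_quot_def add_divide_distrib ring_distribs mult_ac)
qed

lemma G_step_lincomb:
  assumes "f \<in> G_step w" "g \<in> G_step w"
  shows "(\<lambda>x. a * f x + b * g x) \<in> G_step w"
    and "G_norm w m (\<lambda>x. a * f x + b * g x) \<le> cmod a * G_norm w m f + cmod b * G_norm w m g"
proof -
  have C: "C_inf f" "C_inf g" using assms by (simp_all add: mem_G_step)
  have bdd: "bdd_above (G_quot w f ` {(x, \<beta>, \<alpha>). mi_abs \<alpha> \<le> m})"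
      "bdd_above (G_quot w g ` {(x, \<beta>, \<alpha>). mi_abs \<alpha> \<le> m})" for m
    using assms by (simp_all add: mem_G_step)
  have *: "bdd_above (G_quot w (\<lambda>x. a * f x + b * g x) ` {(x, \<beta>, \<alpha>). mi_abs \<alpha> \<le> m})"
      "Sup (G_quot w (\<lambda>x. a * f x + b * g x) ` {(x, \<beta>, \<alpha>). mi_abs \<alpha> \<le> m}) \<le> cmod a * Sup (G_quot w f ` {(x, \<beta>, \<alpha>). mi_abs \<alpha>
          \<le> m}) + cmod b * Sup (G_quot w g ` {(x, \<beta>, \<alpha>). mi_abs \<alpha> \<le> m})" for m
    by (rule Sup_lincomb_le[OF G_index_nonempty norm_ge_zero norm_ge_zero bdd G_quot_lincomb[OF C]])+
  show "(\<lambda>x. a * f x + b * g x) \<in> G_step w"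
    using *(1) C by (simp add: mem_G_step C_inf_lincomb)
  show "G_norm w m (\<lambda>x. a * f x + b * g x) \<le> cmod a * G_norm w m f + cmod b * G_norm w m g"
    unfolding G_norm_def by (rule *(2))
qed

lemma E_step_lincomb:
  assumes "f \<in> E_step w" "g \<in> E_step w"
  shows "(\<lambda>x. a * f x + b * g x) \<in> E_step w"
    and "E_norm w m (\<lambda>x. a * f x + b * g x) \<le> cmod a * E_norm w m f + cmod b * E_norm w m g"
proof -
  have C: "C_inf f" "C_inf g" using assms by (simp_all add: mem_E_step)
  have bdd: "bdd_above (E_quot w m f ` UNIV)" "bdd_above (E_quot w m g ` UNIV)" for m
    using assms by (simp_all add: mem_E_step)
  have *: "bdd_above (E_quot w m (\<lambda>x. a * f x + b * g x) ` UNIV)"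
      "Sup (E_quot w m (\<lambda>x. a * f x + b * g x) ` UNIV)
          \<le> cmod a * Sup (E_quot w m f ` UNIV) + cmod b * Sup (E_quot w m g ` UNIV)" for m
    by (rule Sup_lincomb_le[OF UNIV_not_empty norm_ge_zero norm_ge_zero bdd E_quot_lincomb[OF C]])+
  show "(\<lambda>x. a * f x + b * g x) \<in> E_step w"
    using *(1) C by (simp add: mem_E_step C_inf_lincomb)
  show "E_norm w m (\<lambda>x. a * f x + b * g x) \<le> cmod a * E_norm w m f + cmod b * E_norm w m g"
    unfolding E_norm_def by (rule *(2))
qed

lemma G_quot_le_norm:
  assumes "f \<in> G_step w" "mi_abs \<alpha> \<le> m"
  shows "G_quot w f (x, \<beta>, \<alpha>) \<le> G_norm w m f"
  unfolding G_norm_def using assms by (intro cSup_upper) (auto simp: mem_G_step)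

lemma G_norm_nonneg: "f \<in> G_step w \<Longrightarrow> 0 \<le> G_norm w m f"
  by (rule order.trans[OF _ G_quot_le_norm[of f w 0 m 0 0]])
    (auto simp: G_quot_def mi_abs_def intro: mi_quot_nonneg)

lemma G_norm_mono:
  assumes "f \<in> G_step w" "m \<le> n"
  shows "G_norm w m f \<le> G_norm w n f"
  unfolding G_norm_def
proof (rule cSup_subset_mono)
  show "bdd_above (G_quot w f ` {(x, \<beta>, \<alpha>). mi_abs \<alpha> \<le> n})" using assms by (simp add: mem_G_step)
qed (use assms G_index_nonempty in auto)

section \<open>Multi-indices, monotone weights and factorials\<close>

definition mi_sub :: "'n \<Rightarrow> nat \<Rightarrow> nat ^ 'n::finite \<Rightarrow> nat ^ 'n" where
  "mi_sub j m \<alpha> = (\<chi> i. if i = j then \<alpha> $ i - m else \<alpha> $ i)"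

lemma mi_sub_mi_sub: "mi_sub j m (mi_sub j k \<alpha>) = mi_sub j (m + k) \<alpha>"
  by (auto simp: mi_sub_def vec_eq_iff)

lemma mi_sub_0: "mi_sub j 0 \<alpha> = \<alpha>"
  by (simp add: mi_sub_def vec_eq_iff)

lemma mi_vec_orthant: "mi_vec \<alpha> \<in> orthant"
  by (simp add: mi_vec_def orthant_def)

definition orthant_mono :: "(real ^ 'n::finite \<Rightarrow> real) \<Rightarrow> bool" where
  "orthant_mono w \<longleftrightarrow> (\<forall>x\<in>orthant. \<forall>y. (\<forall>j. x $ j \<le> y $ j) \<longrightarrow> w x \<le> w y)"

text \<open>Condition 2) raises one coordinate at a time; induction over the set of coordinates
  already raised reaches \<open>y\<close>, and the intermediate points stay in the orthant.\<close>

lemma orthant_monoI: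
  fixes w :: "real ^ 'n::finite \<Rightarrow> real"
  assumes "\<And>x j t. x \<in> orthant \<Longrightarrow> x $ j \<le> t \<Longrightarrow> w x \<le> w (\<chi> k. if k = j then t else x $ k)"
  shows "orthant_mono w"
  unfolding orthant_mono_def
proof (intro ballI allI impI)
  fix x y :: "real ^ 'n" assume x: "x \<in> orthant" and xy: "\<forall>j. x $ j \<le> y $ j"
  have "w x \<le> w (\<chi> k. if k \<in> S then y $ k else x $ k)" if "finite S" for S
    using that
  proof induction
    case (insert j S)
    let ?z = "\<chi> k. if k \<in> S then y $ k else x $ k"
    have "\<forall>j. 0 \<le> y $ j" using x xy by (auto simp: orthant_def intro: order.trans)
    then have "?z \<in> orthant" using x by (simp add: orthant_def)
    then have "w ?z \<le> w (\<chi> k. if k = j then y $ j else ?z $ k)"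
      using insert.hyps xy by (intro assms) auto
    also have "(\<chi> k. if k = j then y $ j else ?z $ k) = (\<chi> k. if k \<in> insert j S then y $ k else x $ k)"
      by (auto simp: vec_eq_iff)
    finally show ?case using insert.IH by simp
  qed simp
  from this[OF finite_class.finite_UNIV] show "w x \<le> w y" by simp
qed

lemma orthant_mono_mi_vec:
  "orthant_mono w \<Longrightarrow> (\<And>i. \<alpha> $ i \<le> \<beta> $ i) \<Longrightarrow> w (mi_vec \<alpha>) \<le> w (mi_vec \<beta>)"
  unfolding orthant_mono_def using mi_vec_orthant[of \<alpha>] by (auto simp: mi_vec_def)

text \<open>The factorial of \<open>\<alpha> + (2,...,2)\<close>: it dominates the factorial of
  every multi-index obtained from \<open>\<alpha>\<close> by raising some entries by 2.\<close>

definition mi_fact2 :: "nat ^ 'n::finite \<Rightarrow> real" where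
  "mi_fact2 \<alpha> = (\<Prod>i\<in>UNIV. fact (\<alpha> $ i + 2))"

lemma mi_fact2_pos: "0 < mi_fact2 \<alpha>"
  unfolding mi_fact2_def by (simp add: prod_pos)

text \<open>Closes the later induction: the factor \<open>\<alpha> $ j\<close> from differentiating
  a monomial is absorbed because a (a + 1)! \<le> (a + 2)!. For a = 0 the left side is 0, whatever
  truncated subtraction returns.\<close>

lemma mi_fact2_mi_sub_1: "real (\<alpha> $ j) * mi_fact2 (mi_sub j 1 \<alpha>) \<le> mi_fact2 \<alpha>"
proof -
  have "real a * fact (a - 1 + 2) \<le> fact (a + 2)" for a
    by (cases a) (simp_all add: algebra_simps)
  then have "real (\<alpha> $ j) * fact (\<alpha> $ j - 1 + 2) * (\<Prod>i\<in>UNIV - {j}. fact (\<alpha> $ i + 2))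
      \<le> fact (\<alpha> $ j + 2) * (\<Prod>i\<in>UNIV - {j}. fact (\<alpha> $ i + 2) :: real)"
    by (intro mult_right_mono prod_nonneg) auto
  then show ?thesis
    unfolding mi_fact2_def mi_sub_def
    by (subst (1 2) prod.remove[of _ j]) (simp_all add: mult.assoc)
qed

lemma fact_add_2_le: "fact (a + 2) \<le> 4 * 2 ^ a * (fact a :: real)"
proof -
  have "(a + 1) * (a + 2) \<le> 4 * 2 ^ a"
  proof (induction a)
    case (Suc a)
    \<comment> \<open>From a to a + 1 the left side at most doubles when a \<ge> 1; for a = 0 the
      claim is 6 \<le> 8.\<close>
    then show ?case by (cases a) (auto simp: algebra_simps)
  qed simp
  then have "real ((a + 1) * (a + 2)) \<le> real (4 * 2 ^ a)" by (rule of_nat_mono)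
  then have "real ((a + 1) * (a + 2)) * fact a \<le> 4 * 2 ^ a * fact a" by (intro mult_right_mono) auto
  moreover have "fact (a + 2) = real ((a + 1) * (a + 2)) * fact a" by (simp add: algebra_simps)
  ultimately show ?thesis by simp
qed

text \<open>The power of 2 is written as an exponential of \<open>ln 2\<close> times the coordinate
  sum because this is the term of condition 5) that later cancels it.\<close>

lemma mi_fact2_le:
  fixes \<alpha> :: "nat ^ 'n::finite"
  shows "mi_fact2 \<alpha> \<le> 4 ^ CARD('n) * exp (ln 2 * (\<Sum>j\<in>UNIV. mi_vec \<alpha> $ j)) * mi_fact \<alpha>"
proof -
  have "mi_fact2 \<alpha> \<le> (\<Prod>i\<in>UNIV. 4 * 2 ^ (\<alpha> $ i) * fact (\<alpha> $ i))"
    unfolding mi_fact2_def by (intro prod_mono conjI fact_add_2_le) auto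
  also have "\<dots> = 4 ^ CARD('n) * (\<Prod>i\<in>UNIV. exp (ln 2 * mi_vec \<alpha> $ i)) * mi_fact \<alpha>"
    by (simp add: prod.distrib mi_fact_def mi_vec_def exp_of_nat2_mult)
  also have "(\<Prod>i\<in>UNIV. exp (ln 2 * mi_vec \<alpha> $ i)) = exp (ln 2 * (\<Sum>j\<in>UNIV. mi_vec \<alpha> $ j))"
    by (simp add: exp_sum sum_distrib_left)
  finally show ?thesis .
qed

text \<open>The factor \<open>1 + \<xi>\<^sub>i\<^sup>2\<close> is at most \<open>2\<close> or \<open>2 \<xi>\<^sub>i\<^sup>2\<close>, so decay is bought by raising \<open>\<alpha>\<^sub>i\<close> by \<open>2\<close>
  exactly where \<open>\<bar>\<xi>\<^sub>i\<bar> \<ge> 1\<close>.\<close>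

lemma G_step_decay:
  fixes f :: "real ^ 'n::finite \<Rightarrow> complex"
  assumes w: "orthant_mono w" and f: "f \<in> G_step w"
  shows "cmod (of_real (mi_pow \<xi> \<alpha>) * (partial j ^^ k) f \<xi>)
    \<le> 2 ^ CARD('n) * G_norm w k f * mi_fact2 \<alpha> * exp (- w (mi_vec \<alpha>)) * decay \<xi>"
proof -
  define S where "S = {i. 1 \<le> \<bar>\<xi> $ i\<bar>}"
  define \<beta> where "\<beta> = (\<chi> i. \<alpha> $ i + (if i \<in> S then 2 else 0))"
  \<comment> \<open>The monomial with exponent \<open>\<beta> - \<alpha>\<close>; its factors are at
    least 1, which makes it positive.\<close>
  define P where "P = (\<Prod>i\<in>UNIV. if i \<in> S then (\<xi> $ i)\<^sup>2 else 1)"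
  have P: "P > 0" unfolding P_def by (intro prod_pos) (auto simp: S_def)
  have pow: "mi_pow \<xi> \<beta> = mi_pow \<xi> \<alpha> * P"
    unfolding mi_pow_def P_def \<beta>_def by (subst prod.distrib[symmetric], rule prod.cong) (auto simp: power_add)
  have "1 / decay \<xi> = (\<Prod>i\<in>UNIV. 1 + (\<xi> $ i)\<^sup>2)"
    by (simp add: decay_def prod_dividef)
  also have "\<dots> \<le> (\<Prod>i\<in>UNIV. 2 * (if i \<in> S then (\<xi> $ i)\<^sup>2 else 1))"
  proof (intro prod_mono conjI)
    fix i
    show "1 + (\<xi> $ i)\<^sup>2 \<le> 2 * (if i \<in> S then (\<xi> $ i)\<^sup>2 else 1)"
      using abs_le_square_iff[of 1 "\<xi> $ i"] abs_le_square_iff[of "\<xi> $ i" 1] by (auto simp: S_def)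
  qed auto
  also have "\<dots> = 2 ^ CARD('n) * P" by (simp add: prod.distrib P_def)
  finally have dec: "1 \<le> 2 ^ CARD('n) * P * decay \<xi>"
    using decay_pos[of \<xi>] by (simp add: field_simps)
  let ?g = "(partial j ^^ k) f \<xi>"
  let ?N = "G_norm w k f"
  \<comment> \<open>The multi-index \<open>k e_j\<close> has length \<open>k\<close>, so the norm of
    order \<open>k\<close> sees the pure derivative.\<close>
  have "mi_abs (\<chi> i. if i = j then k else 0) = k" by (simp add: mi_abs_def)
  with G_quot_le_norm[OF f, of "\<chi> i. if i = j then k else 0" k \<xi> \<beta>]
  have "cmod (of_real (mi_pow \<xi> \<beta>) * ?g) \<le> ?N * (mi_fact \<beta> * exp (- w (mi_vec \<beta>)))"
    using mi_fact_pos[of \<beta>] by (simp add: G_quot_def D_axis pos_divide_le_eq)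
  also have "\<dots> \<le> ?N * (mi_fact2 \<alpha> * exp (- w (mi_vec \<alpha>)))"
  proof (intro mult_left_mono mult_mono G_norm_nonneg f)
    \<comment> \<open>\<open>\<beta>\<close> lies between \<open>\<alpha>\<close> and
      \<open>\<alpha> + (2,...,2)\<close>: the upper bound serves the factorial, the lower one the
      weight.\<close>
    show "mi_fact \<beta> \<le> mi_fact2 \<alpha>"
      unfolding mi_fact_def mi_fact2_def by (intro prod_mono conjI fact_mono) (auto simp: \<beta>_def)
    show "exp (- w (mi_vec \<beta>)) \<le> exp (- w (mi_vec \<alpha>))"
      using orthant_mono_mi_vec[OF w, of \<alpha> \<beta>] by (simp add: \<beta>_def)
  qed (use mi_fact2_pos[of \<alpha>] in auto)
  finally have *: "P * cmod (of_real (mi_pow \<xi> \<alpha>) * ?g) \<le> ?N * (mi_fact2 \<alpha> * exp (- w (mi_vec \<alpha>)))"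
    using P by (simp add: pow norm_mult abs_mult mult_ac)
  have "1 * cmod (of_real (mi_pow \<xi> \<alpha>) * ?g) \<le> (2 ^ CARD('n) * P * decay \<xi>) * cmod (of_real (mi_pow \<xi> \<alpha>) * ?g)"
    by (intro mult_right_mono dec) auto
  also have "\<dots> = 2 ^ CARD('n) * decay \<xi> * (P * cmod (of_real (mi_pow \<xi> \<alpha>) * ?g))" by (simp add: mult_ac)
  also have "\<dots> \<le> 2 ^ CARD('n) * decay \<xi> * (?N * (mi_fact2 \<alpha> * exp (- w (mi_vec \<alpha>))))"
    by (intro mult_left_mono *) (use decay_pos[of \<xi>] in auto)
  finally show ?thesis by (simp add: mult_ac)
qed

section \<open>Products of monomials and smooth functions\<close>

lemma continuous_on_mi_pow: "continuous_on UNIV (\<lambda>\<xi>. of_real (mi_pow \<xi> \<alpha>) :: complex)"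
  unfolding mi_pow_def by (intro continuous_intros)

lemma mi_pow_has_partial:
  fixes \<xi> :: "real ^ 'n::finite"
  shows "((\<lambda>t. of_real (mi_pow (\<xi> + t *\<^sub>R axis j 1) \<alpha>) :: complex) has_vector_derivative
    of_real (real (\<alpha> $ j) * mi_pow \<xi> (mi_sub j 1 \<alpha>))) (at 0)"
proof -
  define R where "R = (\<Prod>i\<in>UNIV - {j}. (\<xi> $ i) ^ (\<alpha> $ i))"
  have 1: "mi_pow (\<xi> + t *\<^sub>R axis j 1) \<alpha> = (\<xi> $ j + t) ^ (\<alpha> $ j) * R" for t
    unfolding mi_pow_def R_def by (subst prod.remove[of _ j]) (auto simp: axis_def intro!: prod.cong)
  have 2: "mi_pow \<xi> (mi_sub j 1 \<alpha>) = (\<xi> $ j) ^ (\<alpha> $ j - 1) * R"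
    unfolding mi_pow_def R_def by (subst prod.remove[of _ j]) (auto simp: mi_sub_def intro!: prod.cong)
  \<comment> \<open>For \<open>\<alpha> $ j = 0\<close> the truncated exponent
    \<open>\<alpha> $ j - 1\<close> is harmless, because the factor in front is 0.\<close>
  have "((\<lambda>t. (\<xi> $ j + t) ^ (\<alpha> $ j) * R) has_real_derivative
      real (\<alpha> $ j) * ((\<xi> $ j) ^ (\<alpha> $ j - 1) * R)) (at 0)"
    by (auto intro!: derivative_eq_intros)
  then show ?thesis
    unfolding 1 2 by (intro has_vector_derivative_of_real)
        (simp add: has_real_derivative_iff_has_vector_derivative)
qed

lemma partial_mi_pow_mult:
  assumes "C_inf g"
  shows "partial j (\<lambda>\<xi>. of_real (mi_pow \<xi> \<alpha>) * g \<xi>) =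
      (\<lambda>\<xi>. of_real (real (\<alpha> $ j)) * (of_real (mi_pow \<xi> (mi_sub j 1 \<alpha>)) * g \<xi>)
          + of_real (mi_pow \<xi> \<alpha>) * partial j g \<xi>)"
    and "has_partial j (\<lambda>\<xi>. of_real (mi_pow \<xi> \<alpha>) * g \<xi>) \<xi>"
proof -
  have "((\<lambda>t. of_real (mi_pow (\<xi> + t *\<^sub>R axis j 1) \<alpha>) * g (\<xi> + t *\<^sub>R axis j 1)) has_vector_derivative
      of_real (real (\<alpha> $ j)) * (of_real (mi_pow \<xi> (mi_sub j 1 \<alpha>)) * g \<xi>)
          + of_real (mi_pow \<xi> \<alpha>) * partial j g \<xi>) (at 0)" for \<xi>
    using has_vector_derivative_mult[OF mi_pow_has_partial has_partialD[OF C_inf_has_partial[OF assms]], of \<xi> j \<alpha>]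
    by (simp add: mult_ac add.commute)
  from partial_eqI[of "\<lambda>\<xi>. of_real (mi_pow \<xi> \<alpha>) * g \<xi>", OF this]
  show "partial j (\<lambda>\<xi>. of_real (mi_pow \<xi> \<alpha>) * g \<xi>) =
      (\<lambda>\<xi>. of_real (real (\<alpha> $ j)) * (of_real (mi_pow \<xi> (mi_sub j 1 \<alpha>)) * g \<xi>)
          + of_real (mi_pow \<xi> \<alpha>) * partial j g \<xi>)"
    and "has_partial j (\<lambda>\<xi>. of_real (mi_pow \<xi> \<alpha>) * g \<xi>) \<xi>" by auto
qed

section \<open>The Fourier transformation on the steps\<close>

text \<open>Operations on the transform become operations on the two arguments: differentiating in
  \<open>x_j\<close> raises \<open>\<alpha>_j\<close>, multiplying by \<open>x_j\<close> lowers
  \<open>\<alpha>_j\<close> or differentiates \<open>f\<close>.\<close>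

definition moment :: "(real ^ 'n::finite \<Rightarrow> complex) \<Rightarrow> nat ^ 'n \<Rightarrow> real ^ 'n \<Rightarrow> complex" where
  "moment f \<alpha> = (\<lambda>\<xi>. of_real (mi_pow \<xi> \<alpha>) * f \<xi>)"

lemma continuous_on_moment: "C_inf f \<Longrightarrow> continuous_on UNIV (moment f \<alpha>)"
  unfolding moment_def by (intro continuous_on_mult continuous_on_mi_pow C_inf_continuous)

lemma G_step_C_inf: "f \<in> G_step w \<Longrightarrow> C_inf f"
  by (simp add: mem_G_step)

lemma moment_decay:
  fixes f :: "real ^ 'n::finite \<Rightarrow> complex"
  assumes "orthant_mono w" "f \<in> G_step w"
  shows "cmod (moment ((partial j ^^ k) f) \<alpha> \<xi>)
    \<le> 2 ^ CARD('n) * G_norm w k f * mi_fact2 \<alpha> * exp (- w (mi_vec \<alpha>)) * decay \<xi>"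
  unfolding moment_def by (rule G_step_decay[OF assms])

lemma integrable_moment:
  assumes "orthant_mono w" "f \<in> G_step w"
  shows "integrable lborel (moment f \<alpha>)"
  using decay_bound_integrable[OF continuous_on_moment[OF G_step_C_inf[OF assms(2)]]
      moment_decay[OF assms, where k=0, unfolded funpow_0]] .

text \<open>Integration by parts for the monomial times a derivative of \<open>f\<close>; the
  product rule yields the two summands, and multiplying by i isolates the term with
  \<open>x $ j\<close>.\<close>

lemma fourier_integral_moment_partial:
  fixes f :: "real ^ 'n::finite \<Rightarrow> complex"
  assumes w: "orthant_mono w" and f: "f \<in> G_step w"
  shows "of_real (x $ j) * fourier_integral (moment ((partial j ^^ k) f) \<alpha>) x =
    \<i> * (of_real (real (\<alpha> $ j)) * fourier_integral (moment ((partial j ^^ k) f) (mi_sub j 1 \<alpha>)) x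
      + fourier_integral (moment ((partial j ^^ Suc k) f) \<alpha>) x)"
proof -
  let ?g = "(partial j ^^ k) f"
  have g: "C_inf ?g" "C_inf (partial j ?g)"
    using G_step_C_inf[OF f] by (auto intro: C_inf_funpow C_inf_partial)
  let ?B = "\<lambda>k \<alpha>. 2 ^ CARD('n) * G_norm w k f * mi_fact2 \<alpha> * exp (- w (mi_vec \<alpha>))"
  have nn: "0 \<le> ?B k \<alpha>" for k \<alpha>
    using G_norm_nonneg[OF f, of k] mi_fact2_pos[of \<alpha>] by (intro mult_nonneg_nonneg) auto
  have b: "cmod (moment ?g \<alpha> \<xi>) \<le> ?B k \<alpha> * decay \<xi>"
    "cmod (moment (partial j ?g) \<alpha> \<xi>) \<le> ?B (Suc k) \<alpha> * decay \<xi>" for \<xi> \<alpha>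
    using moment_decay[OF w f, where j=j and k=k] moment_decay[OF w f, where j=j and k="Suc k"] by simp_all
  \<comment> \<open>\<open>fourier_integral_partial\<close> asks for one constant for the function
    and its partial derivative; this sum of nonnegative terms serves both.\<close>
  define C where "C = ?B k \<alpha> + real (\<alpha> $ j) * ?B k (mi_sub j 1 \<alpha>) + ?B (Suc k) \<alpha>"
  have p: "partial j (moment ?g \<alpha>) =
      (\<lambda>\<xi>. of_real (real (\<alpha> $ j)) * moment ?g (mi_sub j 1 \<alpha>) \<xi> + moment (partial j ?g) \<alpha> \<xi>)"
    unfolding moment_def by (rule partial_mi_pow_mult[OF g(1)])
  have "fourier_integral (partial j (moment ?g \<alpha>)) x = - \<i> * of_real (x $ j) * fourier_integral (moment ?g \<alpha>) x"
  proof (rule fourier_integral_partial[where C=C])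
    show "continuous_on UNIV (moment ?g \<alpha>)" "continuous_on UNIV (partial j (moment ?g \<alpha>))"
      unfolding p by (intro continuous_intros continuous_on_moment g)+
    show "has_partial j (moment ?g \<alpha>) \<xi>" for \<xi>
      unfolding moment_def by (rule partial_mi_pow_mult[OF g(1)])
    fix \<xi> :: "real ^ 'n"
    have "?B k \<alpha> \<le> C" "real (\<alpha> $ j) * ?B k (mi_sub j 1 \<alpha>) + ?B (Suc k) \<alpha> \<le> C"
      unfolding C_def using nn[of k \<alpha>] nn[of "Suc k" \<alpha>]
          mult_nonneg_nonneg[OF of_nat_0_le_iff nn[of k "mi_sub j 1 \<alpha>"], of "\<alpha> $ j"]
      by linarith+
    from this[THEN mult_right_mono, OF less_imp_le[OF decay_pos[of \<xi>]]]
    have c: "?B k \<alpha> * decay \<xi> \<le> C * decay \<xi>"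
      "real (\<alpha> $ j) * (?B k (mi_sub j 1 \<alpha>) * decay \<xi>) + ?B (Suc k) \<alpha> * decay \<xi> \<le> C * decay \<xi>"
      by (simp_all only: distrib_right mult.assoc)
    show "cmod (moment ?g \<alpha> \<xi>) \<le> C * decay \<xi>" using b(1) c(1) by (rule order.trans)
    have "cmod (partial j (moment ?g \<alpha>) \<xi>)
        \<le> real (\<alpha> $ j) * cmod (moment ?g (mi_sub j 1 \<alpha>) \<xi>) + cmod (moment (partial j ?g) \<alpha> \<xi>)"
      unfolding p by (rule order.trans[OF norm_triangle_ineq]) (simp add: norm_mult)
    also have "\<dots> \<le> C * decay \<xi>"
      by (rule order.trans[OF add_mono[OF mult_left_mono[OF b(1)] b(2)] c(2)]) simp
    finally show "cmod (partial j (moment ?g \<alpha>) \<xi>) \<le> C * decay \<xi>" .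
  qed
  moreover have "fourier_integral (partial j (moment ?g \<alpha>)) x =
      of_real (real (\<alpha> $ j)) * fourier_integral (moment ?g (mi_sub j 1 \<alpha>)) x
        + fourier_integral (moment (partial j ?g) \<alpha>) x"
  proof -
    have int: "integrable lborel (\<lambda>\<xi>. moment ?g (mi_sub j 1 \<alpha>) \<xi> * exp (\<i> * of_real (x \<bullet> \<xi>)))"
      "integrable lborel (\<lambda>\<xi>. moment (partial j ?g) \<alpha> \<xi> * exp (\<i> * of_real (x \<bullet> \<xi>)))"
      by (rule integrable_character, rule decay_bound_integrable[OF continuous_on_moment[OF g(1)] b(1)],
        rule integrable_character, rule decay_bound_integrable[OF continuous_on_moment[OF g(2)] b(2)])
    show ?thesis
      unfolding fourier_integral_def p distrib_right mult.assoc using int by (simp add: mult.assoc)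
  qed
  ultimately have "of_real (real (\<alpha> $ j)) * fourier_integral (moment ?g (mi_sub j 1 \<alpha>)) x
        + fourier_integral (moment (partial j ?g) \<alpha>) x
            = - \<i> * of_real (x $ j) * fourier_integral (moment ?g \<alpha>) x"
    by simp
  then show ?thesis by (simp add: mult.assoc[symmetric])
qed

text \<open>By integration by parts, induction on \<open>m\<close> replaces the Leibniz formula: each step either lowers
  \<open>\<alpha>\<^sub>j\<close> or differentiates \<open>f\<close> once more.\<close>

lemma fourier_integral_moment_le:
  fixes f :: "real ^ 'n::finite \<Rightarrow> complex"
  assumes w: "orthant_mono w" and f: "f \<in> G_step w"
  shows "\<bar>x $ j\<bar> ^ m * cmod (fourier_integral (moment ((partial j ^^ k) f) \<alpha>) x)
    \<le> 2 ^ m * (2 ^ CARD('n) * (LINT \<xi>|lborel. decay (\<xi> :: real ^ 'n)))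
      * (G_norm w (m + k) f * mi_fact2 \<alpha> * exp (- w (mi_vec (mi_sub j m \<alpha>))))"
proof (induction m arbitrary: k \<alpha>)
  case 0
  have "continuous_on UNIV (moment ((partial j ^^ k) f) \<alpha>)"
    by (intro continuous_on_moment C_inf_funpow G_step_C_inf[OF f])
  from cmod_fourier_integral_le[OF this moment_decay[OF w f]] show ?case
    by (simp add: mi_sub_0 mult_ac)
next
  case (Suc m)
  let ?K = "2 ^ CARD('n) * (LINT \<xi>|lborel. decay (\<xi> :: real ^ 'n))"
  let ?I = "\<lambda>k \<alpha>. fourier_integral (moment ((partial j ^^ k) f) \<alpha>) x"
  let ?e = "\<lambda>m \<alpha>. exp (- w (mi_vec (mi_sub j m \<alpha>)))"
  let ?N = "G_norm w (Suc m + k) f"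
  have K: "0 \<le> 2 ^ m * ?K"
    by (intro mult_nonneg_nonneg integral_nonneg_AE AE_I2) (auto intro: less_imp_le decay_pos)
  have N: "0 \<le> ?N" "G_norm w (m + k) f \<le> ?N"
    by (auto intro: G_norm_nonneg[OF f] G_norm_mono[OF f])
  \<comment> \<open>Lowering \<open>\<alpha>_j\<close> further lowers the weight and raises the
    exponential, so the branch that only differentiates can be brought to the same
    \<open>Suc m\<close>.\<close>
  have e: "?e m \<alpha> \<le> ?e (Suc m) \<alpha>"
  proof -
    have "w (mi_vec (mi_sub j (Suc m) \<alpha>)) \<le> w (mi_vec (mi_sub j m \<alpha>))"
      by (rule orthant_mono_mi_vec[OF w]) (auto simp: mi_sub_def)
    then show ?thesis by simp
  qed
  have "\<bar>x $ j\<bar> ^ Suc m * cmod (?I k \<alpha>) = \<bar>x $ j\<bar> ^ m * cmod (of_real (x $ j) * ?I k \<alpha>)"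
    by (simp add: norm_mult mult_ac)
  also have "\<dots> \<le> \<bar>x $ j\<bar> ^ m * (real (\<alpha> $ j) * cmod (?I k (mi_sub j 1 \<alpha>)) + cmod (?I (Suc k) \<alpha>))"
    unfolding fourier_integral_moment_partial[OF w f]
    by (intro mult_left_mono) (simp_all add: norm_mult order.trans[OF norm_triangle_ineq])
  also have "\<dots> = real (\<alpha> $ j) * (\<bar>x $ j\<bar> ^ m * cmod (?I k (mi_sub j 1 \<alpha>))) + \<bar>x $ j\<bar> ^ m * cmod (?I (Suc k) \<alpha>)"
    by (simp add: algebra_simps)
  also have "\<dots> \<le> real (\<alpha> $ j) * (2 ^ m * ?K * (G_norm w (m + k) f * mi_fact2 (mi_sub j 1 \<alpha>) * ?e (Suc m) \<alpha>))
      + 2 ^ m * ?K * (?N * mi_fact2 \<alpha> * ?e m \<alpha>)"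
    \<comment> \<open>One branch uses the hypothesis at \<open>\<alpha> - e_j\<close> and
      \<open>k\<close>, the other at \<open>\<alpha>\<close> and \<open>k + 1\<close>; adding the
      two is what doubles the constant to \<open>2 ^ Suc m\<close>.\<close>
    using Suc.IH[of k "mi_sub j 1 \<alpha>"] Suc.IH[of "Suc k" \<alpha>]
    by (intro add_mono mult_left_mono) (simp_all add: mi_sub_mi_sub)
  also have "\<dots> = 2 ^ m * ?K * (G_norm w (m + k) f * (real (\<alpha> $ j) * mi_fact2 (mi_sub j 1 \<alpha>)) * ?e (Suc m) \<alpha>
      + ?N * mi_fact2 \<alpha> * ?e m \<alpha>)"
    by (simp add: algebra_simps)
  also have "\<dots> \<le> 2 ^ m * ?K * (?N * mi_fact2 \<alpha> * ?e (Suc m) \<alpha> + ?N * mi_fact2 \<alpha> * ?e (Suc m) \<alpha>)"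
    using K mi_fact2_pos[of \<alpha>] mi_fact2_pos[of "mi_sub j 1 \<alpha>"] N
    by (intro mult_left_mono[OF _ K] add_mono mult_mono e mi_fact2_mi_sub_1) auto
  finally show ?case by (simp add: algebra_simps)
qed

section \<open>Derivatives of the transform\<close>

definition mi_inc :: "'n \<Rightarrow> nat \<Rightarrow> nat ^ 'n::finite \<Rightarrow> nat ^ 'n" where
  "mi_inc j m \<alpha> = (\<chi> i. if i = j then \<alpha> $ i + m else \<alpha> $ i)"

lemma mult_moment: "of_real (\<xi> $ j) * moment f \<alpha> \<xi> = moment f (mi_inc j 1 \<alpha>) \<xi>"
proof -
  have "mi_pow \<xi> (mi_inc j 1 \<alpha>) = \<xi> $ j * mi_pow \<xi> \<alpha>"
    unfolding mi_pow_def mi_inc_def by (subst (1 2) prod.remove[of _ j]) (auto intro!: prod.cong)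
  then show ?thesis by (simp add: moment_def)
qed

text \<open>Functions of this shape are closed under partial derivatives, the scalar
  \<open>c\<close> taking up the factor i; smoothness and all higher derivatives follow by
  induction.\<close>

lemma fourier_integral_moment_has_partial:
  assumes "\<And>\<alpha>. integrable lborel (moment f \<alpha>)"
  shows "partial j (\<lambda>x. c * fourier_integral (moment f \<alpha>) x)
      = (\<lambda>x. c * \<i> * fourier_integral (moment f (mi_inc j 1 \<alpha>)) x)"
    and "has_partial j (\<lambda>x. c * fourier_integral (moment f \<alpha>) x) x"
proof -
  have "((\<lambda>t. c * fourier_integral (moment f \<alpha>) (x + t *\<^sub>R axis j 1)) has_vector_derivative
      c * \<i> * fourier_integral (moment f (mi_inc j 1 \<alpha>)) x) (at 0)" for x
    using has_vector_derivative_mult_right[OF fourier_integral_has_partial[of "moment f \<alpha>" j x], of c] assms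
    by (simp add: mult_moment mult.assoc)
  from partial_eqI[of "\<lambda>x. c * fourier_integral (moment f \<alpha>) x", OF this]
  show "partial j (\<lambda>x. c * fourier_integral (moment f \<alpha>) x)
      = (\<lambda>x. c * \<i> * fourier_integral (moment f (mi_inc j 1 \<alpha>)) x)"
    and "has_partial j (\<lambda>x. c * fourier_integral (moment f \<alpha>) x) x" by auto
qed

lemma C_inf_fourier_integral_moment:
  assumes "\<And>\<alpha>. integrable lborel (moment f \<alpha>)"
  shows "C_inf (\<lambda>x. c * fourier_integral (moment f \<alpha>) x)"
proof -
  have "C_k k (\<lambda>x. c * fourier_integral (moment f \<alpha>) x)" for k
    by (induction k arbitrary: c \<alpha>)
      (auto intro!: continuous_intros continuous_on_fourier_integral
        simp: fourier_integral_moment_has_partial assms)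
  then show ?thesis by (simp add: C_inf_def)
qed

lemma D_fourier_integral:
  fixes f :: "real ^ 'n::finite \<Rightarrow> complex"
  assumes int: "\<And>\<alpha>. integrable lborel (moment f \<alpha>)"
  shows "cmod (D \<alpha> (\<lambda>x. c * fourier_integral (moment f 0) x) x)
      = cmod c * cmod (fourier_integral (moment f \<alpha>) x)"
proof -
  have pow: "(partial j ^^ k) (\<lambda>x. c * fourier_integral (moment f \<beta>) x)
      = (\<lambda>x. c * \<i> ^ k * fourier_integral (moment f (mi_inc j k \<beta>)) x)" for j k c \<beta>
  proof (induction k)
    case 0
    have "mi_inc j 0 \<beta> = \<beta>" by (simp add: mi_inc_def vec_eq_iff)
    then show ?case by simp
  next
    case (Suc k)
    have "mi_inc j 1 (mi_inc j k \<beta>) = mi_inc j (Suc k) \<beta>" by (simp add: mi_inc_def vec_eq_iff)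
    then show ?case
      by (simp only: funpow.simps comp_apply Suc fourier_integral_moment_has_partial(1)[OF int])
          (simp add: mult_ac)
  qed
  \<comment> \<open>The factors i accumulate in \<open>c'\<close>, of which only the modulus is
    recorded; the multi-index holds the entries of the coordinates processed so far.\<close>
  have "\<exists>c'. cmod c' = cmod c \<and> foldr (\<lambda>i. partial i ^^ (\<alpha> $ i)) xs (\<lambda>x. c * fourier_integral (moment f 0) x)
      = (\<lambda>x. c' * fourier_integral (moment f (\<chi> i. if i \<in> set xs then \<alpha> $ i else 0)) x)"
    if "distinct xs" for xs
    using that
  proof (induction xs)
    case Nil
    have "(\<chi> i. 0) = (0 :: nat ^ 'n)" by (simp add: vec_eq_iff)
    then show ?case by auto
  next
    case (Cons j xs)
    then obtain c' where c': "cmod c' = cmod c"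
      "foldr (\<lambda>i. partial i ^^ (\<alpha> $ i)) xs (\<lambda>x. c * fourier_integral (moment f 0) x)
      = (\<lambda>x. c' * fourier_integral (moment f (\<chi> i. if i \<in> set xs then \<alpha> $ i else 0)) x)"
      by auto
    have "mi_inc j (\<alpha> $ j) (\<chi> i. if i \<in> set xs then \<alpha> $ i else 0)
        = (\<chi> i. if i \<in> set (j # xs) then \<alpha> $ i else 0)"
      using Cons.prems by (auto simp: mi_inc_def vec_eq_iff)
    with c' show ?case
      by (intro exI[of _ "c' * \<i> ^ (\<alpha> $ j)"]) (simp add: pow norm_mult norm_power)
  qed
  from this[OF coords(1)] show ?thesis
    by (auto simp: D_def coords(2) norm_mult)
qed

lemma fourier_eq: "fourier f = (\<lambda>x. 1 / of_real (sqrt (2 * pi) ^ CARD('n)) * fourier_integral (moment f 0) x)"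
  for f :: "real ^ 'n::finite \<Rightarrow> complex"
  by (simp add: fun_eq_iff fourier_def fourier_integral_def moment_def mi_pow_def)

section \<open>From the weight conditions to the norm estimate\<close>

lemma weight_familyD:
  assumes "weight_family h" "1 \<le> \<nu>"
  shows "orthant_mono (h \<nu>)"
    and "\<exists>\<gamma>. \<forall>x\<in>orthant. h \<nu> x - h (\<nu> + 1) x \<ge> ln 2 * (\<Sum>j\<in>UNIV. x $ j) - \<gamma>"
    and "\<exists>l. \<forall>x\<in>orthant. \<forall>y\<in>orthant. h (\<nu> + 1) (x + y) \<le> h \<nu> x + h \<nu> y + l"
proof -
  note * = mp[OF spec[OF assms(1)[unfolded weight_family_def], of \<nu>] assms(2)]
  show "orthant_mono (h \<nu>)"
    by (rule orthant_monoI) (rule *[THEN conjunct2, THEN conjunct2, THEN conjunct1, rule_format])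
  show "\<exists>\<gamma>. \<forall>x\<in>orthant. h \<nu> x - h (\<nu> + 1) x \<ge> ln 2 * (\<Sum>j\<in>UNIV. x $ j) - \<gamma>"
    using * by (elim conjE)
  show "\<exists>l. \<forall>x\<in>orthant. \<forall>y\<in>orthant. h (\<nu> + 1) (x + y) \<le> h \<nu> x + h \<nu> y + l"
    using * by (elim conjE)
qed

text \<open>Taking for \<open>j\<close> the coordinate of largest modulus reduces the weight to a
  power of one coordinate, so integration by parts in a single direction suffices.\<close>

lemma power_one_plus_norm_le:
  fixes x :: "real ^ 'n::finite"
  obtains j where "(1 + norm x) ^ m \<le> (1 + real CARD('n)) ^ m * (1 + \<bar>x $ j\<bar> ^ m)"
proof -
  obtain j where j: "\<And>i. \<bar>x $ i\<bar> \<le> \<bar>x $ j\<bar>"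
  proof -
    have "Max (range (\<lambda>i. \<bar>x $ i\<bar>)) \<in> range (\<lambda>i. \<bar>x $ i\<bar>)" by (intro Max_in) auto
    then obtain j where "Max (range (\<lambda>i. \<bar>x $ i\<bar>)) = \<bar>x $ j\<bar>" by blast
    moreover have "\<bar>x $ i\<bar> \<le> Max (range (\<lambda>i. \<bar>x $ i\<bar>))" for i by (intro Max_ge) auto
    ultimately show thesis by (intro that[of j]) simp
  qed
  \<comment> \<open>The maximum with 1 covers the points near the origin; its m-th power is at most
    1 plus the m-th power of \<open>\<bar>x $ j\<bar>\<close>.\<close>
  let ?M = "max 1 \<bar>x $ j\<bar>"
  have "norm x \<le> (\<Sum>i\<in>UNIV. \<bar>x $ i\<bar>)" by (rule norm_le_l1_cart)
  also have "\<dots> \<le> real CARD('n) * \<bar>x $ j\<bar>" using sum_bounded_above[of UNIV "\<lambda>i. \<bar>x $ i\<bar>"] j by simp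
  also have "\<dots> \<le> real CARD('n) * ?M" by (intro mult_left_mono) auto
  finally have "1 + norm x \<le> (1 + real CARD('n)) * ?M" by (simp add: distrib_right)
  then have "(1 + norm x) ^ m \<le> ((1 + real CARD('n)) * ?M) ^ m" by (intro power_mono) auto
  also have "\<dots> = (1 + real CARD('n)) ^ m * ?M ^ m" by (simp add: power_mult_distrib)
  also have "\<dots> \<le> (1 + real CARD('n)) ^ m * (1 + \<bar>x $ j\<bar> ^ m)"
    by (intro mult_left_mono) (auto simp: max_def)
  finally show thesis by (rule that)
qed

text \<open>Condition 6) splits \<open>\<alpha>\<close> into the lowered multi-index and a remainder
  with entries at most \<open>m\<close>, whose weight is bounded; condition 5) at
  \<open>\<nu> + 1\<close> supplies the exponential that absorbs the passage from
  \<open>mi_fact2\<close> to \<open>mi_fact\<close>. Each use raises the index by 1.\<close>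

lemma exp_weight_mi_sub_le:
  fixes h :: "nat \<Rightarrow> real ^ 'n::finite \<Rightarrow> real"
  assumes h: "weight_family h" and \<nu>: "1 \<le> \<nu>"
  obtains c where "0 \<le> c" "\<And>j \<alpha>. mi_fact2 \<alpha> * exp (- h \<nu> (mi_vec (mi_sub j m \<alpha>)))
    \<le> c * (mi_fact \<alpha> * exp (- h (\<nu> + 2) (mi_vec \<alpha>)))"
proof -
  obtain l where l: "\<And>x y. x \<in> orthant \<Longrightarrow> y \<in> orthant \<Longrightarrow> h (\<nu> + 1) (x + y) \<le> h \<nu> x + h \<nu> y + l"
    using weight_familyD(3)[OF h \<nu>] by auto
  obtain \<gamma> where \<gamma>: "\<And>x. x \<in> orthant \<Longrightarrow> h (\<nu> + 1) x - h (\<nu> + 2) x \<ge> ln 2 * (\<Sum>j\<in>UNIV. x $ j) - \<gamma>"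
    using weight_familyD(2)[OF h, of "\<nu> + 1"] by auto
  \<comment> \<open>\<open>(m,...,m)\<close> dominates every remainder, which makes the bound
    independent of \<open>j\<close> and \<open>\<alpha>\<close>.\<close>
  define H where "H = h \<nu> (mi_vec (\<chi> i. m))"
  have "mi_fact2 \<alpha> * exp (- h \<nu> (mi_vec (mi_sub j m \<alpha>)))
    \<le> 4 ^ CARD('n) * exp (H + l + \<gamma>) * (mi_fact \<alpha> * exp (- h (\<nu> + 2) (mi_vec \<alpha>)))" for j \<alpha>
  proof -
    \<comment> \<open>What truncated subtraction really removes: all of \<open>\<alpha> $ j\<close>
      if it is smaller than \<open>m\<close>.\<close>
    let ?y = "\<chi> i. if i = j then min m (\<alpha> $ i) else 0"
    let ?s = "ln 2 * (\<Sum>j\<in>UNIV. mi_vec \<alpha> $ j)"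
    have "mi_vec \<alpha> = mi_vec (mi_sub j m \<alpha>) + mi_vec ?y"
      by (auto simp: mi_vec_def mi_sub_def vec_eq_iff of_nat_diff min_def)
    then have "h (\<nu> + 1) (mi_vec \<alpha>) \<le> h \<nu> (mi_vec (mi_sub j m \<alpha>)) + h \<nu> (mi_vec ?y) + l"
      using l[OF mi_vec_orthant mi_vec_orthant] by metis
    also have "h \<nu> (mi_vec ?y) \<le> H"
      unfolding H_def by (rule orthant_mono_mi_vec[OF weight_familyD(1)[OF h \<nu>]]) simp
    finally have "- h \<nu> (mi_vec (mi_sub j m \<alpha>)) \<le> (H + l + \<gamma>) - h (\<nu> + 2) (mi_vec \<alpha>) - ?s"
      using \<gamma>[OF mi_vec_orthant[of \<alpha>]] by simp
    then have "exp (- h \<nu> (mi_vec (mi_sub j m \<alpha>))) \<le> exp ((H + l + \<gamma>) - h (\<nu> + 2) (mi_vec \<alpha>) - ?s)"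
      by simp
    then have "mi_fact2 \<alpha> * exp (- h \<nu> (mi_vec (mi_sub j m \<alpha>)))
        \<le> (4 ^ CARD('n) * exp ?s * mi_fact \<alpha>) * exp ((H + l + \<gamma>) - h (\<nu> + 2) (mi_vec \<alpha>) - ?s)"
      using mi_fact_pos[of \<alpha>] by (intro mult_mono mi_fact2_le) auto
    also have "\<dots> = 4 ^ CARD('n) * mi_fact \<alpha> * (exp ?s * exp ((H + l + \<gamma>) - h (\<nu> + 2) (mi_vec \<alpha>) - ?s))"
      by simp
    also have "exp ?s * exp ((H + l + \<gamma>) - h (\<nu> + 2) (mi_vec \<alpha>) - ?s)
        = exp (H + l + \<gamma>) * exp (- h (\<nu> + 2) (mi_vec \<alpha>))"
      unfolding exp_add[symmetric] by simp
    finally show ?thesis by (simp add: mult_ac)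
  qed
  then show thesis by (intro that[of "4 ^ CARD('n) * exp (H + l + \<gamma>)"]) auto
qed

text \<open>\<open>C\<close> is chosen before \<open>f\<close> and \<open>p\<close>: this uniformity
  yields finite norms of the transform and later the continuity of the step maps.\<close>

lemma E_quot_fourier_le:
  fixes h :: "nat \<Rightarrow> real ^ 'n::finite \<Rightarrow> real"
  assumes h: "weight_family h" and \<nu>: "1 \<le> \<nu>"
  obtains C where "0 \<le> C"
    "\<And>f p. f \<in> G_step (h \<nu>) \<Longrightarrow> E_quot (h (\<nu> + 2)) m (fourier f) p \<le> C * G_norm (h \<nu>) m f"
proof -
  note w = weight_familyD(1)[OF h \<nu>]
  obtain c where c: "0 \<le> c" "\<And>j \<alpha>. mi_fact2 \<alpha> * exp (- h \<nu> (mi_vec (mi_sub j m \<alpha>)))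
    \<le> c * (mi_fact \<alpha> * exp (- h (\<nu> + 2) (mi_vec \<alpha>)))"
    using exp_weight_mi_sub_le[OF h \<nu>, where m=m] by blast
  define K where "K = 2 ^ CARD('n) * (LINT \<xi>|lborel. decay (\<xi> :: real ^ 'n))"
  have K: "0 \<le> K"
    unfolding K_def by (intro mult_nonneg_nonneg integral_nonneg_AE AE_I2) (auto intro: less_imp_le decay_pos)
  define a where "a = cmod (1 / of_real (sqrt (2 * pi) ^ CARD('n)))"
  \<comment> \<open>In order: comparison of the norm with one coordinate, normalisation of the
    transform, the estimates for the powers 0 and \<open>m\<close>, the integral of
    \<open>decay\<close> with its factor \<open>2 ^ CARD('n)\<close>, the change of weights.\<close>
  define C where "C = (1 + real CARD('n)) ^ m * (a * ((1 + 2 ^ m) * (K * c)))"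
  have "E_quot (h (\<nu> + 2)) m (fourier f) (x, \<alpha>) \<le> C * G_norm (h \<nu>) m f" if f: "f \<in> G_step (h \<nu>)" for f x \<alpha>
  proof -
    let ?q = "mi_fact \<alpha> * exp (- h (\<nu> + 2) (mi_vec \<alpha>))"
    let ?N = "G_norm (h \<nu>) m f"
    let ?I = "cmod (fourier_integral (moment f \<alpha>) x)"
    obtain j where j: "(1 + norm x) ^ m \<le> (1 + real CARD('n)) ^ m * (1 + \<bar>x $ j\<bar> ^ m)"
      by (rule power_one_plus_norm_le)
    have D: "cmod (D \<alpha> (fourier f) x) = a * ?I"
      unfolding fourier_eq a_def by (rule D_fourier_integral) (rule integrable_moment[OF w f])
    have N: "0 \<le> ?N" "G_norm (h \<nu>) 0 f \<le> ?N"
      by (auto intro: G_norm_nonneg[OF f] G_norm_mono[OF f])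
    have "?I \<le> K * (G_norm (h \<nu>) 0 f * (mi_fact2 \<alpha> * exp (- h \<nu> (mi_vec \<alpha>))))"
      using fourier_integral_moment_le[OF w f, where m=0 and k=0 and \<alpha>=\<alpha> and x=x]
      by (simp add: K_def mi_sub_0 mult.assoc)
    \<comment> \<open>The estimate for the power 0 is weakened to the norm and weight of the
      estimate for the power \<open>m\<close>, so that the two can be added.\<close>
    also have "\<dots> \<le> K * (?N * (mi_fact2 \<alpha> * exp (- h \<nu> (mi_vec (mi_sub j m \<alpha>)))))"
    proof (intro mult_left_mono mult_mono)
      have "h \<nu> (mi_vec (mi_sub j m \<alpha>)) \<le> h \<nu> (mi_vec \<alpha>)"
        by (rule orthant_mono_mi_vec[OF w]) (simp add: mi_sub_def)
      then show "exp (- h \<nu> (mi_vec \<alpha>)) \<le> exp (- h \<nu> (mi_vec (mi_sub j m \<alpha>)))" by simp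
    qed (use K N mi_fact2_pos[of \<alpha>] in auto)
    finally have I0: "?I \<le> K * (?N * (mi_fact2 \<alpha> * exp (- h \<nu> (mi_vec (mi_sub j m \<alpha>)))))" .
    have Im: "\<bar>x $ j\<bar> ^ m * ?I \<le> 2 ^ m * K * (?N * (mi_fact2 \<alpha> * exp (- h \<nu> (mi_vec (mi_sub j m \<alpha>)))))"
      using fourier_integral_moment_le[OF w f, where m=m and k=0 and \<alpha>=\<alpha> and x=x and j=j]
      by (simp add: K_def mult.assoc)
    have "(1 + \<bar>x $ j\<bar> ^ m) * ?I \<le> (1 + 2 ^ m) * K * (?N * (mi_fact2 \<alpha> * exp (- h \<nu> (mi_vec (mi_sub j m \<alpha>)))))"
      using add_mono[OF I0 Im] by (simp add: algebra_simps)
    also have "\<dots> \<le> (1 + 2 ^ m) * K * (?N * (c * ?q))"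
      using K N by (intro mult_left_mono c) auto
    finally have *: "(1 + \<bar>x $ j\<bar> ^ m) * ?I \<le> (1 + 2 ^ m) * K * (?N * (c * ?q))" .
    have "(1 + norm x) ^ m * cmod (D \<alpha> (fourier f) x) \<le> (1 + real CARD('n)) ^ m * (1 + \<bar>x $ j\<bar> ^ m) * (a * ?I)"
      unfolding D by (intro mult_right_mono j) (simp add: a_def)
    also have "\<dots> = (1 + real CARD('n)) ^ m * (a * ((1 + \<bar>x $ j\<bar> ^ m) * ?I))" by simp
    also have "\<dots> \<le> (1 + real CARD('n)) ^ m * (a * ((1 + 2 ^ m) * K * (?N * (c * ?q))))"
      by (intro mult_left_mono *) (auto simp: a_def)
    also have "\<dots> = C * ?N * ?q" by (simp add: C_def mult_ac)
    finally show ?thesis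
      using mi_fact_pos[of \<alpha>] by (simp add: E_quot_def pos_divide_le_eq)
  qed
  moreover have "0 \<le> C" unfolding C_def a_def using K c(1) by (intro mult_nonneg_nonneg) auto
  ultimately show thesis by (intro that[of C]) auto
qed

lemma fourier_E_step:
  fixes h :: "nat \<Rightarrow> real ^ 'n::finite \<Rightarrow> real"
  assumes h: "weight_family h" and \<nu>: "1 \<le> \<nu>" and f: "f \<in> G_step (h \<nu>)"
  shows "fourier f \<in> E_step (h (\<nu> + 2))"
  unfolding mem_E_step
proof (intro conjI allI)
  show "C_inf (fourier f)"
    unfolding fourier_eq using integrable_moment[OF weight_familyD(1)[OF h \<nu>] f]
    by (rule C_inf_fourier_integral_moment)
  fix m
  obtain C where "0 \<le> C" "\<And>f p. f \<in> G_step (h \<nu>) \<Longrightarrow> E_quot (h (\<nu> + 2)) m (fourier f) p \<le> C * G_norm (h \<nu>) m f"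
    using E_quot_fourier_le[OF h \<nu>, where m=m] by blast
  then show "bdd_above (range (E_quot (h (\<nu> + 2)) m (fourier f)))" using f
      by (intro bdd_aboveI2[where M="C * G_norm (h \<nu>) m f"]) blast
qed

lemma E_norm_fourier_le:
  fixes h :: "nat \<Rightarrow> real ^ 'n::finite \<Rightarrow> real"
  assumes h: "weight_family h" and \<nu>: "1 \<le> \<nu>"
  obtains C where "0 \<le> C"
    "\<And>f. f \<in> G_step (h \<nu>) \<Longrightarrow> E_norm (h (\<nu> + 2)) m (fourier f) \<le> C * G_norm (h \<nu>) m f"
proof -
  obtain C where "0 \<le> C"
    "\<And>f p. f \<in> G_step (h \<nu>) \<Longrightarrow> E_quot (h (\<nu> + 2)) m (fourier f) p \<le> C * G_norm (h \<nu>) m f"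
    using E_quot_fourier_le[OF h \<nu>, where m=m] by blast
  then show thesis by (intro that[of C]; simp only: E_norm_def; intro cSUP_least) simp_all
qed

section \<open>Linearity and nested steps\<close>

lemma fourier_lincomb:
  assumes "integrable lborel f" "integrable lborel g"
  shows "fourier (\<lambda>x. a * f x + b * g x) = (\<lambda>x. a * fourier f x + b * fourier g x)"
proof
  fix x
  have "(LINT \<xi>|lborel. (a * f \<xi> + b * g \<xi>) * exp (\<i> * of_real (x \<bullet> \<xi>)))
      = (LINT \<xi>|lborel. a * (f \<xi> * exp (\<i> * of_real (x \<bullet> \<xi>))) + b * (g \<xi> * exp (\<i> * of_real (x \<bullet> \<xi>))))"
    by (simp add: distrib_right mult.assoc)
  also have "\<dots> = a * (LINT \<xi>|lborel. f \<xi> * exp (\<i> * of_real (x \<bullet> \<xi>)))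
      + b * (LINT \<xi>|lborel. g \<xi> * exp (\<i> * of_real (x \<bullet> \<xi>)))"
    using integrable_character[OF assms(1), of x] integrable_character[OF assms(2), of x] by simp
  finally show "fourier (\<lambda>x. a * f x + b * g x) x = a * fourier f x + b * fourier g x"
    by (simp add: fourier_def distrib_left mult_ac)
qed

text \<open>Dropping the nonnegative sum in condition 5) shows that \<open>h (Suc \<nu>)\<close>
  exceeds \<open>h \<nu>\<close> on multi-indices by at most a constant; this makes the steps
  increase with \<open>\<nu>\<close>.\<close>

lemma exp_weight_Suc_le:
  assumes h: "weight_family h" and \<nu>: "1 \<le> \<nu>"
  obtains c where "0 \<le> c" "\<And>\<beta>. exp (- h \<nu> (mi_vec \<beta>)) \<le> c * exp (- h (Suc \<nu>) (mi_vec \<beta>))"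
proof -
  obtain \<gamma> where \<gamma>: "\<And>x. x \<in> orthant \<Longrightarrow> h \<nu> x - h (\<nu> + 1) x \<ge> ln 2 * (\<Sum>j\<in>UNIV. x $ j) - \<gamma>"
    using weight_familyD(2)[OF h \<nu>] by auto
  have "exp (- h \<nu> (mi_vec \<beta>)) \<le> exp \<gamma> * exp (- h (Suc \<nu>) (mi_vec \<beta>))" for \<beta>
  proof -
    have "0 \<le> ln 2 * (\<Sum>j\<in>UNIV. mi_vec \<beta> $ j)"
      by (intro mult_nonneg_nonneg sum_nonneg) (auto simp: mi_vec_def)
    then have "- h \<nu> (mi_vec \<beta>) \<le> \<gamma> - h (Suc \<nu>) (mi_vec \<beta>)" using \<gamma>[OF mi_vec_orthant[of \<beta>]] by simp
    then show ?thesis unfolding exp_add[symmetric] by simp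
  qed
  then show thesis by (intro that[of "exp \<gamma>"]) auto
qed

lemma divide_weight_le:
  assumes "0 \<le> t" "exp r \<le> c * exp s"
  shows "t / (mi_fact \<beta> * exp s) \<le> c * (t / (mi_fact \<beta> * exp r))"
proof -
  have "t / mi_fact \<beta> * exp r \<le> t / mi_fact \<beta> * (c * exp s)"
    using assms mi_fact_pos[of \<beta>] by (intro mult_left_mono) auto
  then show ?thesis using mi_fact_pos[of \<beta>] by (simp add: field_simps)
qed

lemma bdd_above_image_le_mult:
  fixes q q' :: "'p \<Rightarrow> real"
  assumes "bdd_above (q' ` A)" "0 \<le> c" and q: "\<And>p. q p \<le> c * q' p"
  shows "bdd_above (q ` A)"
proof -
  obtain B where B: "\<And>p. p \<in> A \<Longrightarrow> q' p \<le> B" using assms(1) by (auto simp: bdd_above_def)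
  show ?thesis
    by (rule bdd_aboveI2[of _ _ "c * B"]) (rule order.trans[OF q mult_left_mono[OF B assms(2)]])
qed

lemma
  assumes h: "weight_family h" and \<nu>: "1 \<le> \<nu>"
  shows G_step_Suc: "G_step (h \<nu>) \<subseteq> G_step (h (Suc \<nu>))"
    and E_step_Suc: "E_step (h \<nu>) \<subseteq> E_step (h (Suc \<nu>))"
proof -
  obtain c where c: "0 \<le> c" "\<And>\<beta>. exp (- h \<nu> (mi_vec \<beta>)) \<le> c * exp (- h (Suc \<nu>) (mi_vec \<beta>))"
    using exp_weight_Suc_le[OF h \<nu>] by blast
  have G: "G_quot (h (Suc \<nu>)) f p \<le> c * G_quot (h \<nu>) f p" for f p
    by (cases p) (simp only: G_quot_def prod.case, intro divide_weight_le c norm_ge_zero)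
  have "bdd_above (G_quot (h (Suc \<nu>)) f ` A)" if "bdd_above (G_quot (h \<nu>) f ` A)" for f A
    by (rule bdd_above_image_le_mult[OF that c(1) G])
  then show "G_step (h \<nu>) \<subseteq> G_step (h (Suc \<nu>))" by (auto simp: mem_G_step)
  have E: "E_quot (h (Suc \<nu>)) m f p \<le> c * E_quot (h \<nu>) m f p" for m f p
    by (cases p)
        (simp only: E_quot_def prod.case, intro divide_weight_le c mult_nonneg_nonneg zero_le_power norm_ge_zero, simp)
  have "bdd_above (range (E_quot (h (Suc \<nu>)) m f))" if "bdd_above (range (E_quot (h \<nu>) m f))" for m f
    by (rule bdd_above_image_le_mult[OF that c(1) E])
  then show "E_step (h \<nu>) \<subseteq> E_step (h (Suc \<nu>))" by (auto simp: mem_E_step)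
qed

lemma fun_subspaceI:
  assumes "V \<noteq> {}" and lin: "\<And>a b f g. f \<in> V \<Longrightarrow> g \<in> V \<Longrightarrow> (\<lambda>x. a * f x + b * g x) \<in> V"
  shows "fun_subspace V"
  unfolding fun_subspace_def
proof (intro conjI ballI allI)
  obtain f where "f \<in> V" using assms(1) by blast
  then show "(\<lambda>x. 0) \<in> V" using lin[of f f 0 0] by simp
  show "(\<lambda>x. f x + g x) \<in> V" if "f \<in> V" "g \<in> V" for f g using lin[OF that, of 1 1] by simp
  show "(\<lambda>x. c * f x) \<in> V" if "f \<in> V" for c f using lin[OF that that, of c 0] by simp
qed

text \<open>Needed for closure of the unions under addition, where both summands have to be placed
  in one step.\<close>

lemma UN_chain_common:
  fixes S :: "nat \<Rightarrow> 'a set"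
  assumes Suc: "\<And>\<nu>. 1 \<le> \<nu> \<Longrightarrow> S \<nu> \<subseteq> S (Suc \<nu>)"
    and "f \<in> (\<Union>\<nu>\<in>{1..}. S \<nu>)" "g \<in> (\<Union>\<nu>\<in>{1..}. S \<nu>)"
  obtains \<nu> where "1 \<le> \<nu>" "f \<in> S \<nu>" "g \<in> S \<nu>"
proof -
  have mono: "S i \<subseteq> S j" if "1 \<le> i" "i \<le> j" for i j
    using that(2)
  proof (induction rule: dec_induct)
    case (step k)
    with that(1) have "S k \<subseteq> S (Suc k)" by (intro Suc) simp
    with step.IH show ?case by (rule subset_trans)
  qed simp
  from assms(2,3) obtain i j where "1 \<le> i" "f \<in> S i" "1 \<le> j" "g \<in> S j" by auto
  with mono[of i "max i j"] mono[of j "max i j"] show thesis by (intro that[of "max i j"]) auto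
qed

section \<open>Linear maps between locally convex inductive limits\<close>

text \<open>The balls are a generating family of the target topology, so only their preimages have
  to be shown open, by a ball around each point. The triangle inequality is asked for on
  \<open>W\<close>, where the suprema behind the norms are finite.\<close>

lemma continuous_map_norms_topology:
  fixes F :: "('a \<Rightarrow> complex) \<Rightarrow> 'b \<Rightarrow> complex"
  assumes p0: "\<And>m. p m (\<lambda>x. 0) = 0" and q0: "\<And>m. q m (\<lambda>x. 0) = 0"
    and F: "\<And>f. f \<in> V \<Longrightarrow> F f \<in> W"
    and V: "\<And>f g. f \<in> V \<Longrightarrow> g \<in> V \<Longrightarrow> (\<lambda>x. f x - g x) \<in> V"
    and diff: "\<And>f g. f \<in> V \<Longrightarrow> g \<in> V \<Longrightarrow> F (\<lambda>x. f x - g x) = (\<lambda>x. F f x - F g x)"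
    and tri: "\<And>m u v w. u \<in> W \<Longrightarrow> v \<in> W \<Longrightarrow> w \<in> W \<Longrightarrow>
      q m (\<lambda>x. u x - w x) \<le> q m (\<lambda>x. u x - v x) + q m (\<lambda>x. v x - w x)"
    and bound: "\<And>m. \<exists>C\<ge>0. \<exists>k. \<forall>f\<in>V. q m (F f) \<le> C * p k f"
  shows "continuous_map (norms_topology V p) (norms_topology W q) F"
proof -
  let ?T = "norms_topology V p"
  have tV: "topspace ?T = V" by (rule topspace_norms_topology) (rule p0)
  have tW: "topspace (norms_topology W q) = W" by (rule topspace_norms_topology) (rule q0)
  have ball: "openin ?T {g \<in> V. p k (\<lambda>x. g x - f x) < d}" if "f \<in> V" "d > 0" for k f d
    unfolding norms_topology_def by (rule topology_generated_by_Basis) (use that in blast)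
  show ?thesis
    unfolding norms_topology_def[of W q]
  proof (rule continuous_on_generated_topo)
    show "F ` topspace ?T \<subseteq> \<Union> {{g \<in> W. q m (\<lambda>x. g x - f x) < e} |m f e. f \<in> W \<and> 0 < e}"
      using F unfolding tV topology_generated_by_topspace[symmetric] norms_topology_def[symmetric] tW by blast
    fix U assume "U \<in> {{g \<in> W. q m (\<lambda>x. g x - f x) < e} |m f e. f \<in> W \<and> 0 < e}"
    then obtain m f0 e where U: "U = {g \<in> W. q m (\<lambda>x. g x - f0 x) < e}" and f0: "f0 \<in> W" by blast
    obtain C k where C: "0 \<le> C" and Cb: "\<And>f. f \<in> V \<Longrightarrow> q m (F f) \<le> C * p k f"
      using bound by blast
    show "openin ?T (F -` U \<inter> topspace ?T)"
    proof (subst openin_subopen, intro ballI)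
      fix f assume "f \<in> F -` U \<inter> topspace ?T"
      then have f: "f \<in> V" and fe: "q m (\<lambda>x. F f x - f0 x) < e" by (auto simp: U tV)
      \<comment> \<open>Dividing by \<open>C + 1\<close> admits \<open>C = 0\<close> and makes
        \<open>C * d\<close> strictly smaller than the gap.\<close>
      define d where "d = (e - q m (\<lambda>x. F f x - f0 x)) / (C + 1)"
      have d: "0 < d" using fe C by (simp add: d_def)
      have Cd: "C * d < e - q m (\<lambda>x. F f x - f0 x)"
      proof -
        have "C * d < (C + 1) * d" using d by (simp add: distrib_right)
        also have "\<dots> = e - q m (\<lambda>x. F f x - f0 x)" using C by (simp add: d_def)
        finally show ?thesis .
      qed
      have "{g \<in> V. p k (\<lambda>x. g x - f x) < d} \<subseteq> F -` U \<inter> topspace ?T"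
      proof safe
        fix g assume g: "g \<in> V" and gd: "p k (\<lambda>x. g x - f x) < d"
        have "q m (\<lambda>x. F g x - f0 x) \<le> q m (\<lambda>x. F g x - F f x) + q m (\<lambda>x. F f x - f0 x)"
          by (intro tri F f g f0)
        also have "q m (\<lambda>x. F g x - F f x) \<le> C * p k (\<lambda>x. g x - f x)"
          using Cb[OF V[OF g f]] by (simp add: diff f g)
        also have "\<dots> \<le> C * d" using gd C by (intro mult_left_mono) auto
        finally show "g \<in> F -` U" using Cd F[OF g] by (simp add: U)
      qed (simp add: tV)
      moreover have "f \<in> {g \<in> V. p k (\<lambda>x. g x - f x) < d}" using f d p0 by simp
      ultimately show "\<exists>T. openin ?T T \<and> f \<in> T \<and> T \<subseteq> F -` U \<inter> topspace ?T"
        using ball[OF f d] by blast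
    qed
  qed
qed

lemma linear_operator_on_convex_comb:
  assumes F: "linear_operator_on V W F" and f: "f \<in> V" and g: "g \<in> V"
  shows "(\<lambda>x. (1 - t) *\<^sub>R f x + t *\<^sub>R g x) \<in> V"
    and "F (\<lambda>x. (1 - t) *\<^sub>R f x + t *\<^sub>R g x) = (\<lambda>x. (1 - t) *\<^sub>R F f x + t *\<^sub>R F g x)"
proof -
  have sub: "fun_subspace V"
    and add: "\<And>f g. f \<in> V \<Longrightarrow> g \<in> V \<Longrightarrow> F (\<lambda>x. f x + g x) = (\<lambda>x. F f x + F g x)"
    and scale: "\<And>c f. f \<in> V \<Longrightarrow> F (\<lambda>x. c * f x) = (\<lambda>x. c * F f x)"
    using F unfolding linear_operator_on_def by blast+
  have Vadd: "\<And>f g. f \<in> V \<Longrightarrow> g \<in> V \<Longrightarrow> (\<lambda>x. f x + g x) \<in> V"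
    and Vscale: "\<And>c f. f \<in> V \<Longrightarrow> (\<lambda>x. c * f x) \<in> V"
    using sub unfolding fun_subspace_def by blast+
  show "(\<lambda>x. (1 - t) *\<^sub>R f x + t *\<^sub>R g x) \<in> V"
    unfolding scaleR_conv_of_real by (rule Vadd[OF Vscale[OF f] Vscale[OF g]])
  show "F (\<lambda>x. (1 - t) *\<^sub>R f x + t *\<^sub>R g x) = (\<lambda>x. (1 - t) *\<^sub>R F f x + t *\<^sub>R F g x)"
    unfolding scaleR_conv_of_real add[OF Vscale[OF f] Vscale[OF g]] scale[OF f] scale[OF g] ..
qed

text \<open>Open sets of the pullback are preimages, and a map into it is continuous once its
  composition with \<open>F\<close> is. Linearity moves \<open>F\<close> past addition and scalar
  multiplication, and makes preimages of convex sets convex.\<close>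

lemma lc_topology_on_pullback:
  assumes \<tau>: "lc_topology_on W \<tau>" and F: "linear_operator_on V W F"
  shows "lc_topology_on V (pullback_topology V F \<tau>)"
proof -
  let ?P = "pullback_topology V F \<tau>"
  have V: "fun_subspace V" and FW: "\<And>f. f \<in> V \<Longrightarrow> F f \<in> W"
    and add: "\<And>f g. f \<in> V \<Longrightarrow> g \<in> V \<Longrightarrow> F (\<lambda>x. f x + g x) = (\<lambda>x. F f x + F g x)"
    and scale: "\<And>c f. f \<in> V \<Longrightarrow> F (\<lambda>x. c * f x) = (\<lambda>x. c * F f x)"
    using F unfolding linear_operator_on_def by blast+
  have V0: "(\<lambda>x. 0) \<in> V" and Vadd: "\<And>f g. f \<in> V \<Longrightarrow> g \<in> V \<Longrightarrow> (\<lambda>x. f x + g x) \<in> V"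
    and Vscale: "\<And>c f. f \<in> V \<Longrightarrow> (\<lambda>x. c * f x) \<in> V"
    using V unfolding fun_subspace_def by blast+
  have F0: "F (\<lambda>x. 0) = (\<lambda>x. 0)" using scale[OF V0, of 0] by simp
  have tW: "topspace \<tau> = W"
    and cadd: "continuous_map (prod_topology \<tau> \<tau>) \<tau> (\<lambda>(f, g). (\<lambda>x. f x + g x))"
    and cscale: "continuous_map (prod_topology euclidean \<tau>) \<tau> (\<lambda>(c :: complex, f). (\<lambda>x. c * f x))"
    and lc: "\<And>U. openin \<tau> U \<Longrightarrow> (\<lambda>x. 0) \<in> U \<Longrightarrow>
      \<exists>W. openin \<tau> W \<and> (\<lambda>x. 0) \<in> W \<and> W \<subseteq> U \<and> fun_convex W"
    using \<tau> unfolding lc_topology_on_def by blast+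
  have tV: "topspace ?P = V" unfolding topspace_pullback_topology tW using FW by blast
  have cF: "continuous_map ?P \<tau> F"
    using continuous_map_pullback[OF continuous_map_id, of V F \<tau>] by simp
  have "continuous_map (prod_topology ?P ?P) ?P (\<lambda>(f, g). (\<lambda>x. f x + g x))"
  proof (rule continuous_map_pullback')
    have "continuous_map (prod_topology ?P ?P) (prod_topology \<tau> \<tau>) (\<lambda>(f, g). (F f, F g))"
      using cF by (simp add: continuous_map_prod_top)
    from continuous_map_compose[OF this cadd]
    show "continuous_map (prod_topology ?P ?P) \<tau> (F \<circ> (\<lambda>(f, g). (\<lambda>x. f x + g x)))"
      by (rule continuous_map_eq) (auto simp: tV add)
  qed (auto simp: tV Vadd)
  moreover have "continuous_map (prod_topology euclidean ?P) ?P (\<lambda>(c :: complex, f). (\<lambda>x. c * f x))"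
  proof (rule continuous_map_pullback')
    have "continuous_map (prod_topology euclidean ?P) (prod_topology euclidean \<tau>) (\<lambda>(c :: complex, f). (id c, F f))"
      using cF by (simp only: continuous_map_prod_top continuous_map_id simp_thms)
    from continuous_map_compose[OF this cscale]
    show "continuous_map (prod_topology euclidean ?P) \<tau> (F \<circ> (\<lambda>(c :: complex, f). (\<lambda>x. c * f x)))"
      by (rule continuous_map_eq) (auto simp: tV scale)
  qed (auto simp: tV Vscale)
  moreover have "\<exists>S. openin ?P S \<and> (\<lambda>x. 0) \<in> S \<and> S \<subseteq> U \<and> fun_convex S"
    if U: "openin ?P U" "(\<lambda>x. 0) \<in> U" for U
  proof -
    obtain U' where U': "openin \<tau> U'" "U = F -` U' \<inter> V" using U(1) by (auto simp: openin_pullback_topology)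
    with U(2) F0 have "(\<lambda>x. 0) \<in> U'" by simp
    from lc[OF U'(1) this] obtain S where S: "openin \<tau> S" "(\<lambda>x. 0) \<in> S" "S \<subseteq> U'" "fun_convex S" by blast
    have "fun_convex (F -` S \<inter> V)"
      using S(4) unfolding fun_convex_def by (auto simp: linear_operator_on_convex_comb[OF F])
    moreover have "openin ?P (F -` S \<inter> V)" using S(1) unfolding openin_pullback_topology by blast
    ultimately show ?thesis using S U' V0 F0 by (intro exI[of _ "F -` S \<inter> V"]) auto
  qed
  ultimately show ?thesis unfolding lc_topology_on_def using V tV by blast
qed

text \<open>Every admissible topology on the target pulls back along \<open>F\<close> to an admissible topology on the
  source.\<close>

lemma continuous_map_lc_inductive_limit:
  assumes F: "linear_operator_on (\<Union>i\<in>I. topspace (T i)) (\<Union>j\<in>J. topspace (S j)) F"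
    and step: "\<And>i. i \<in> I \<Longrightarrow> \<exists>j\<in>J. continuous_map (T i) (S j) F"
  shows "continuous_map (lc_inductive_limit I T) (lc_inductive_limit J S) F"
proof -
  let ?V = "\<Union>i\<in>I. topspace (T i)" and ?W = "\<Union>j\<in>J. topspace (S j)"
  have tV: "topspace (lc_inductive_limit I T) = ?V" and tW: "topspace (lc_inductive_limit J S) = ?W"
    using F by (auto intro!: topspace_lc_inductive_limit simp only: linear_operator_on_def)
  show ?thesis
    unfolding lc_inductive_limit_def[of J]
  proof (rule continuous_on_generated_topo)
    have "F ` ?V \<subseteq> ?W" using F unfolding linear_operator_on_def by blast
    moreover have "\<Union> {U. \<exists>\<tau>. lc_topology_on ?W \<tau> \<and>
        (\<forall>i\<in>J. continuous_map (S i) \<tau> (\<lambda>f. f)) \<and> openin \<tau> U} = ?W"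
      using tW unfolding lc_inductive_limit_def topology_generated_by_topspace .
    ultimately show "F ` topspace (lc_inductive_limit I T) \<subseteq> \<Union> {U. \<exists>\<tau>. lc_topology_on ?W \<tau> \<and>
        (\<forall>i\<in>J. continuous_map (S i) \<tau> (\<lambda>f. f)) \<and> openin \<tau> U}"
      unfolding tV by (simp only:)
    fix U assume "U \<in> {U. \<exists>\<tau>. lc_topology_on ?W \<tau> \<and> (\<forall>i\<in>J. continuous_map (S i) \<tau> (\<lambda>f. f)) \<and> openin \<tau> U}"
    then obtain \<tau> where \<tau>: "lc_topology_on ?W \<tau>" "\<And>j. j \<in> J \<Longrightarrow> continuous_map (S j) \<tau> (\<lambda>f. f)" "openin \<tau> U"
      by blast
    \<comment> \<open>Once this topology is shown to be admissible, the preimage of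
      \<open>U\<close>, being open in it, is one of the generators of the limit topology on the
      source.\<close>
    let ?P = "pullback_topology ?V F \<tau>"
    have "continuous_map (T i) ?P (\<lambda>f. f)" if i: "i \<in> I" for i
    proof (rule continuous_map_pullback')
      obtain j where "j \<in> J" "continuous_map (T i) (S j) F" using step[OF i] by blast
      then show "continuous_map (T i) \<tau> (F \<circ> (\<lambda>f. f))"
        using continuous_map_compose[of "T i" "S j" F \<tau> "\<lambda>f. f"] \<tau>(2) by (simp add: comp_def)
    qed (use i in blast)
    moreover have "openin ?P (F -` U \<inter> ?V)" using \<tau>(3) unfolding openin_pullback_topology by blast
    ultimately have "F -` U \<inter> ?V \<in> {U. \<exists>\<tau>. lc_topology_on ?V \<tau> \<and>
        (\<forall>i\<in>I. continuous_map (T i) \<tau> (\<lambda>f. f)) \<and> openin \<tau> U}"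
      using lc_topology_on_pullback[OF \<tau>(1) F] by blast
    then have "openin (lc_inductive_limit I T) (F -` U \<inter> ?V)"
      unfolding lc_inductive_limit_def by (rule topology_generated_by_Basis)
    then show "openin (lc_inductive_limit I T) (F -` U \<inter> topspace (lc_inductive_limit I T))"
      by (simp only: tV)
  qed
qed

section \<open>The Fourier transformation on \<open>G(\<H>)\<close>\<close>

lemma C_inf_const: "C_inf (\<lambda>x :: real ^ 'n::finite. c)"
proof -
  have "C_k k (\<lambda>x :: real ^ 'n. c)" for k
  proof (induction k arbitrary: c)
    case (Suc k)
    have "((\<lambda>t. c) has_vector_derivative 0) (at 0)" by simp
    then have "partial i (\<lambda>x :: real ^ 'n. c) x = 0" "has_partial i (\<lambda>x :: real ^ 'n. c) x" for i x
      using partial_eqI[of "\<lambda>x :: real ^ 'n. c" x i 0] by simp_all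
    then have "partial i (\<lambda>x :: real ^ 'n. c) = (\<lambda>x. 0)" "has_partial i (\<lambda>x :: real ^ 'n. c) x" for i x
      by auto
    with Suc show ?case by simp
  qed simp
  then show ?thesis by (simp add: C_inf_def)
qed

lemma D_0: "D \<alpha> (\<lambda>x. 0) = (\<lambda>x. 0)"
  using D_lincomb[OF C_inf_const C_inf_const, of \<alpha> 0 0 0 0] by simp

lemma zero_G_step: "(\<lambda>x. 0) \<in> G_step w" and G_norm_0: "G_norm w m (\<lambda>x. 0) = 0"
proof -
  have q: "G_quot w (\<lambda>x. 0) = (\<lambda>p. 0)" by (auto simp: G_quot_def D_0)
  have "G_quot w (\<lambda>x. 0) ` {(x, \<beta>, \<alpha>). mi_abs \<alpha> \<le> m} = {0}" for m
    unfolding q image_constant_conv by (rule if_not_P) (rule G_index_nonempty)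
  then show "(\<lambda>x. 0) \<in> G_step w" "G_norm w m (\<lambda>x. 0) = 0"
    by (simp_all only: mem_G_step C_inf_const G_norm_def) auto
qed

lemma zero_E_step: "(\<lambda>x. 0) \<in> E_step w" and E_norm_0: "E_norm w m (\<lambda>x. 0) = 0"
proof -
  have "E_quot w m (\<lambda>x. 0) = (\<lambda>p. 0)" for m by (auto simp: E_quot_def D_0)
  then show "(\<lambda>x. 0) \<in> E_step w" "E_norm w m (\<lambda>x. 0) = 0"
    by (simp_all add: mem_E_step C_inf_const E_norm_def image_constant_conv)
qed

lemma fun_subspace_G_space:
  assumes h: "weight_family h"
  shows "fun_subspace (G_space h)"
proof (rule fun_subspaceI)
  show "G_space h \<noteq> {}" using zero_G_step[of "h 1"] by (auto simp: G_space_def)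
  fix a b f g assume "f \<in> G_space h" "g \<in> G_space h"
  then obtain \<nu> where "1 \<le> \<nu>" "f \<in> G_step (h \<nu>)" "g \<in> G_step (h \<nu>)"
    using UN_chain_common[of "\<lambda>\<nu>. G_step (h \<nu>)" f g] G_step_Suc[OF h] unfolding G_space_def by blast
  then show "(\<lambda>x. a * f x + b * g x) \<in> G_space h" by (auto simp: G_space_def intro: G_step_lincomb)
qed

lemma fun_subspace_E_space:
  assumes h: "weight_family h"
  shows "fun_subspace (E_space h)"
proof (rule fun_subspaceI)
  show "E_space h \<noteq> {}" using zero_E_step[of "h 1"] by (auto simp: E_space_def)
  fix a b f g assume "f \<in> E_space h" "g \<in> E_space h"
  then obtain \<nu> where "1 \<le> \<nu>" "f \<in> E_step (h \<nu>)" "g \<in> E_step (h \<nu>)"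
    using UN_chain_common[of "\<lambda>\<nu>. E_step (h \<nu>)" f g] E_step_Suc[OF h] unfolding E_space_def by blast
  then show "(\<lambda>x. a * f x + b * g x) \<in> E_space h" by (auto simp: E_space_def intro: E_step_lincomb)
qed

lemma integrable_G_step:
  assumes "orthant_mono w" "f \<in> G_step w"
  shows "integrable lborel f"
  using integrable_moment[OF assms, of 0] by (simp add: moment_def mi_pow_def)

lemma G_space_lincomb_fourier:
  assumes h: "weight_family h" and f: "f \<in> G_space h" and g: "g \<in> G_space h"
  shows "fourier (\<lambda>x. a * f x + b * g x) = (\<lambda>x. a * fourier f x + b * fourier g x)"
proof -
  have "integrable lborel f" if "f \<in> G_space h" for f
    using that integrable_G_step[OF weight_familyD(1)[OF h]] by (auto simp: G_space_def)
  then show ?thesis using f g by (intro fourier_lincomb)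
qed

text \<open>The uniqueness theorem needs a decay bound for the difference, hence a single step: both
  functions are placed in a common one, which contains their difference.\<close>

lemma fourier_inj_on:
  fixes h :: "nat \<Rightarrow> real ^ 'n::finite \<Rightarrow> real"
  assumes h: "weight_family h"
  shows "inj_on fourier (G_space h)"
proof (rule inj_onI, rule ext)
  fix f g :: "real ^ 'n \<Rightarrow> complex" and y
  assume fg: "f \<in> G_space h" "g \<in> G_space h" "fourier f = fourier g"
  obtain \<nu> where \<nu>: "1 \<le> \<nu>" "f \<in> G_step (h \<nu>)" "g \<in> G_step (h \<nu>)"
    using UN_chain_common[of "\<lambda>\<nu>. G_step (h \<nu>)" f g] G_step_Suc[OF h] fg unfolding G_space_def by blast
  define u where "u = (\<lambda>x. 1 * f x + (- 1) * g x)"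
  have u: "u \<in> G_step (h \<nu>)" unfolding u_def by (rule G_step_lincomb[OF \<nu>(2,3)])
  have "u y = 0"
  proof (rule fourier_integral_eq_0_imp)
    show "continuous_on UNIV u" by (rule C_inf_continuous[OF G_step_C_inf[OF u]])
    show "cmod (u \<xi>)
        \<le> 2 ^ CARD('n) * G_norm (h \<nu>) 0 u * mi_fact2 (0 :: nat ^ 'n) * exp (- h \<nu> (mi_vec 0)) * decay \<xi>" for \<xi>
      using moment_decay[OF weight_familyD(1)[OF h \<nu>(1)] u, where k=0 and \<alpha>=0]
          by (simp add: moment_def mi_pow_def)
    have "fourier u = (\<lambda>x. 0)"
      unfolding u_def G_space_lincomb_fourier[OF h fg(1,2)] using fg(3) by simp
    then have "fourier u x = 0" for x by simp
    then show "fourier_integral u x = 0" for x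
      by (simp add: fourier_eq moment_def mi_pow_def)
  qed
  then show "f y = g y" by (simp add: u_def)
qed

lemma fourier_linear_operator_on:
  assumes h: "weight_family h"
  shows "linear_operator_on (G_space h) (E_space h) fourier"
  unfolding linear_operator_on_def
proof (intro conjI ballI allI fun_subspace_G_space[OF h] fun_subspace_E_space[OF h])
  show "fourier f \<in> E_space h" if "f \<in> G_space h" for f
    using that fourier_E_step[OF h] unfolding G_space_def E_space_def by fastforce
  show "fourier (\<lambda>x. f x + g x) = (\<lambda>x. fourier f x + fourier g x)"
    if "f \<in> G_space h" "g \<in> G_space h" for f g
    using G_space_lincomb_fourier[OF h that, of 1 1] by simp
  show "fourier (\<lambda>x. c * f x) = (\<lambda>x. c * fourier f x)" if "f \<in> G_space h" for c f
    using G_space_lincomb_fourier[OF h that that, of c 0] by simp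
qed

lemma fourier_continuous_map_step:
  fixes h :: "nat \<Rightarrow> real ^ 'n::finite \<Rightarrow> real"
  assumes h: "weight_family h" and \<nu>: "1 \<le> \<nu>"
  shows "continuous_map (norms_topology (G_step (h \<nu>)) (G_norm (h \<nu>)))
    (norms_topology (E_step (h (\<nu> + 2))) (E_norm (h (\<nu> + 2)))) fourier"
proof (rule continuous_map_norms_topology)
  show "(\<lambda>x. f x - g x) \<in> G_step (h \<nu>)" if "f \<in> G_step (h \<nu>)" "g \<in> G_step (h \<nu>)" for f g
    using G_step_lincomb(1)[OF that, of 1 "- 1"] by simp
  show "fourier (\<lambda>x. f x - g x) = (\<lambda>x. fourier f x - fourier g x)"
    if "f \<in> G_step (h \<nu>)" "g \<in> G_step (h \<nu>)" for f g
    using fourier_lincomb[OF that[THEN integrable_G_step[OF weight_familyD(1)[OF h \<nu>]]], of 1 "- 1"] by simp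
  show "E_norm (h (\<nu> + 2)) m (\<lambda>x. u x - w x)
      \<le> E_norm (h (\<nu> + 2)) m (\<lambda>x. u x - v x) + E_norm (h (\<nu> + 2)) m (\<lambda>x. v x - w x)"
    if "u \<in> E_step (h (\<nu> + 2))" "v \<in> E_step (h (\<nu> + 2))" "w \<in> E_step (h (\<nu> + 2))" for m u v w
    using E_step_lincomb(2)[OF E_step_lincomb(1)[OF that(1,2), of 1 "- 1"]
        E_step_lincomb(1)[OF that(2,3), of 1 "- 1"], of m 1 1]
    by simp
  show "\<exists>C\<ge>0. \<exists>k. \<forall>f\<in>G_step (h \<nu>). E_norm (h (\<nu> + 2)) m (fourier f) \<le> C * G_norm (h \<nu>) k f" for m
  proof -
    obtain C where "0 \<le> C" "\<And>f. f \<in> G_step (h \<nu>) \<Longrightarrow> E_norm (h (\<nu> + 2)) m (fourier f) \<le> C * G_norm (h \<nu>) m f"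
      using E_norm_fourier_le[OF h \<nu>, where m=m] by blast
    then show ?thesis by (intro exI[of _ C] conjI exI[of _ m] ballI)
  qed
qed (simp_all only: G_norm_0 E_norm_0 fourier_E_step[OF h \<nu>])

theorem mainTheorem2:
  fixes h :: "nat \<Rightarrow> real ^ 'n::finite \<Rightarrow> real"
  assumes "weight_family h"
  shows "linear_operator_on (G_space h) (E_space h) fourier
    \<and> inj_on fourier (G_space h)
    \<and> continuous_map (G_top h) (E_top h) fourier"
proof (intro conjI fourier_inj_on fourier_linear_operator_on assms)
  let ?T = "\<lambda>\<nu>. norms_topology (G_step (h \<nu>)) (G_norm (h \<nu>))"
  let ?S = "\<lambda>\<nu>. norms_topology (E_step (h \<nu>)) (E_norm (h \<nu>))"
  have "linear_operator_on (\<Union>\<nu>\<in>{1..}. topspace (?T \<nu>)) (\<Union>\<nu>\<in>{1..}. topspace (?S \<nu>)) fourier"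
  proof -
    have "topspace (?T \<nu>) = G_step (h \<nu>)" for \<nu> by (rule topspace_norms_topology) (rule G_norm_0)
    moreover have "topspace (?S \<nu>) = E_step (h \<nu>)" for \<nu> by (rule topspace_norms_topology) (rule E_norm_0)
    ultimately show ?thesis
      using fourier_linear_operator_on[OF assms] by (simp only: G_space_def E_space_def)
  qed
  \<comment> \<open>Each source step may have its own target step, so the loss of two indices does
    no harm in the limit.\<close>
  moreover have "\<exists>\<mu>\<in>{1..}. continuous_map (?T \<nu>) (?S \<mu>) fourier" if "\<nu> \<in> {1..}" for \<nu>
    using fourier_continuous_map_step[OF assms, of \<nu>] that by (intro bexI[of _ "\<nu> + 2"]) auto
  ultimately show "continuous_map (G_top h) (E_top h) fourier"
    unfolding G_top_def E_top_def by (rule continuous_map_lc_inductive_limit)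
qed

end
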